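(* Let $A$ be a finite alphabet and let $R$ be an equivalence relation on $A^*$ realized by a letter-to-letter transducer. Let $S_R$ be the syntactic congruence of $R$ and $P_R$ the prefix closure of $R$. The following are equivalent: 1. $R\in\mathbf{KerSeq}$; 2. $S_R$ has finite index with respect to $R$, and $R$ has finite index with respect to $P_R^+$; 3. $S_R$ has finite index with respect to $R$, $R$ has finite index with respect to $P_R$, and there exists $k$ such that $P_R^k=P_R^{k+1}$.
   Context: Alphabets are finite. A finite transducer over alphabets $A,B$ is a tuple $(Q,\Delta,I,F)$ with $Q$ a finite set of states, $\Delta$ a finite set of transitions $(p,(x,y),q)$ with $p,q\in Q$, $(x,y)\in A^*\times B^*$, and $I,F\subseteq Q$ the initial and final states. It realizes the relation of all pairs $(u,v)$ such that some path from an initial to a final state has $u$ as the concatenation of its first components and $v$ as the concatenation of its second components. It is letter-to-letter if all transition labels are in $A\times B$. It is sequential if all transition labels are in $A\times B^*$, there is one initial state, and for each state $p$ and letter $a\in A$ there is at most one transition from $p$ with input letter $a$. $\mathbf{KerSeq}$ is the class of equivalence relations on some $A^*$ of the form $\ker(f)=\{(u,v)\mid f(u)=f(v)\}$ with $f:A^*\to B^*$ a total function realized by a sequential transducer. Syntactic congruence: $u\,S_R\,v$ iff $uw\,R\,vw$ for every $w\in A^*$. Prefix closure: $u\,P_R\,v$ iff there exist $u',v'\in A^*$ with $|u'|=|v'|$ and $uu'\,R\,vv'$. $P_R^k$ is the $k$-fold composition of $P_R$ with itself, and $P_R^+$ is the transitive closure of $P_R$ (the smallest transitive relation containing $P_R$).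 For relations $S\subseteq T$ on $A^*$ (not necessarily transitive), the index of $S$ with respect to $T$ is the supremum of $|X|$ over all words $u$ and all sets $X\subseteq T(u)=\{v\mid uTv\}$ such that no two distinct $v,w\in X$ satisfy $vSw$. (If $S\subseteq T$ are equivalence relations, this is the supremum of the number of $S$-classes contained in a single $T$-class.) *)

theory Defs
  imports Main "HOL-Library.Extended_Nat"
begin

text \<open>An alphabet is a finite set \<open>A\<close>, possibly empty, and \<open>A\<^sup>*\<close> is \<open>lists A\<close>.\<close>

record ('q, 'a, 'b) transducer =
  states :: "'q set"
  transitions :: "('q \<times> ('a list \<times> 'b list) \<times> 'q) set"
  initial_states :: "'q set"
  final_states :: "'q set"

definition finite_transducer :: "'a set \<Rightarrow> 'b set \<Rightarrow> ('q, 'a, 'b) transducer \<Rightarrow> bool" where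
  "finite_transducer A B T \<longleftrightarrow>
     finite (states T) \<and> finite (transitions T) \<and>
     transitions T \<subseteq> states T \<times> (lists A \<times> lists B) \<times> states T \<and>
     initial_states T \<subseteq> states T \<and> final_states T \<subseteq> states T"

inductive path :: "('q, 'a, 'b) transducer \<Rightarrow> 'q \<Rightarrow> 'a list \<Rightarrow> 'b list \<Rightarrow> 'q \<Rightarrow> bool"
  for T where
  path_Nil: "p \<in> states T \<Longrightarrow> path T p [] [] p"
| path_Cons: "(p, (x, y), q) \<in> transitions T \<Longrightarrow> path T q u v r \<Longrightarrow> path T p (x @ u) (y @ v) r"

definition realized_rel :: "('q, 'a, 'b) transducer \<Rightarrow> ('a list \<times> 'b list) set" where
  "realized_rel T = {(u, v). \<exists>p\<in>initial_states T. \<exists>q\<in>final_states T. path T p u v q}"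

definition letter_to_letter :: "'a set \<Rightarrow> 'b set \<Rightarrow> ('q, 'a, 'b) transducer \<Rightarrow> bool" where
  "letter_to_letter A B T \<longleftrightarrow>
     (\<forall>(p, (x, y), q)\<in>transitions T. \<exists>a\<in>A. \<exists>b\<in>B. x = [a] \<and> y = [b])"

definition sequential :: "'a set \<Rightarrow> 'b set \<Rightarrow> ('q, 'a, 'b) transducer \<Rightarrow> bool" where
  "sequential A B T \<longleftrightarrow>
     (\<forall>(p, (x, y), q)\<in>transitions T. \<exists>a\<in>A. x = [a] \<and> y \<in> lists B) \<and>
     (\<exists>i. initial_states T = {i}) \<and>
     (\<forall>p a y q y' q'. (p, ([a], y), q) \<in> transitions T \<longrightarrow>
        (p, ([a], y'), q') \<in> transitions T \<longrightarrow> y = y' \<and> q = q')"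

definition kernel_on :: "'a set \<Rightarrow> ('a list \<Rightarrow> 'c) \<Rightarrow> 'a list rel" where
  "kernel_on A f = {(u, v). u \<in> lists A \<and> v \<in> lists A \<and> f u = f v}"

text \<open>States and output letters range over \<open>nat\<close> because types cannot be quantified
  inside a formula; this is no restriction, since a finite transducer has finitely
  many states and a finite output alphabet.\<close>

definition KerSeq :: "'a list rel set" where
  "KerSeq = {R. \<exists>(A :: 'a set) (B :: nat set) (f :: 'a list \<Rightarrow> nat list)
                  (T :: (nat, 'a, nat) transducer).
     finite A \<and> finite B \<and> finite_transducer A B T \<and> sequential A B T \<and>
     realized_rel T = {(u, f u) | u. u \<in> lists A} \<and> R = kernel_on A f}"

definition syntactic_congruence :: "'a set \<Rightarrow> 'a list rel \<Rightarrow> 'a list rel" where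
  "syntactic_congruence A R =
     {(u, v). u \<in> lists A \<and> v \<in> lists A \<and> (\<forall>w\<in>lists A. (u @ w, v @ w) \<in> R)}"

definition prefix_closure :: "'a set \<Rightarrow> 'a list rel \<Rightarrow> 'a list rel" where
  "prefix_closure A R =
     {(u, v). u \<in> lists A \<and> v \<in> lists A \<and>
        (\<exists>u'\<in>lists A. \<exists>v'\<in>lists A. length u' = length v' \<and> (u @ u', v @ v') \<in> R)}"

definition ecard :: "'b set \<Rightarrow> enat" where
  "ecard X = (if finite X then enat (card X) else \<infinity>)"

definition rel_index :: "'b rel \<Rightarrow> 'b rel \<Rightarrow> enat" where
  "rel_index S T =
     (SUP X\<in>{X. \<exists>u. X \<subseteq> T `` {u} \<and> (\<forall>v\<in>X. \<forall>w\<in>X. v \<noteq> w \<longrightarrow> (v, w) \<notin> S)}. ecard X)"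

definition finite_index :: "'b rel \<Rightarrow> 'b rel \<Rightarrow> bool" where
  "finite_index S T \<longleftrightarrow> rel_index S T < \<infinity>"

text \<open>In the theorem, relation powers are taken with exponent at least 1, because
  \<^term>\<open>r ^^ 0\<close> is the identity on the whole type rather than on \<open>lists A\<close>.\<close>

end

theory Submission
  imports Defs "HOL-Library.Sublist"
begin

text \<open>Write \<open>E\<close> for the transitive closure of the prefix closure \<open>P\<close>.

If \<open>R\<close> is the kernel of a sequential function \<open>f\<close>, then, \<open>R\<close> being length-preserving, every letter
has nonempty output, and \<open>P\<close>-related words have prefix-comparable images whose lengths differ by a
bounded amount. Hence all images of an \<open>E\<close>-class extend the shortest one, \<open>W\<close>. Cut each word
of the class where its image leaves \<open>W\<close>: the images at the cuts have boundedly many values, distinct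
cut positions give distinct values, and along a \<open>P\<close>-chain the cut moves by bounded steps. So all
cuts are close to the end of the word, and the images extend \<open>W\<close> by boundedly many letters.

Conversely, if \<open>S\<close> has finite index in \<open>E\<close>, an \<open>E\<close>-class is, up to \<open>S\<close>, a bounded set of words,
and there are finitely many configurations of residuals on such sets. A transducer remembers the
configuration and the place of the current word in it. Its output names the successive
\<open>E\<close>-classes, followed by a padding that encodes the \<open>R\<close>-class within the \<open>E\<close>-class and that is
completed to full length before the next letter.

Finally, \<open>S\<close> has finite index in \<open>E\<close> exactly if \<open>S\<close> has finite index in \<open>P\<close> and the powers of
\<open>P\<close> become stationary, since \<open>P\<close> is compatible with \<open>S\<close> and a shortest \<open>P\<close>-chain does not visit an
\<open>S\<close>-class twice.\<close>

section \<open>Relative index\<close>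

text \<open>A supremum in \<open>enat\<close> below infinity is a natural number that bounds all its
  members, so one \<open>N\<close> serves for every \<open>u\<close> and \<open>X\<close>. Infinite
  \<open>X\<close> are excluded because \<open>ecard\<close> gives them infinity.\<close>

lemma finite_index_iff:
  "finite_index S T \<longleftrightarrow>
    (\<exists>N. \<forall>u X. X \<subseteq> T `` {u} \<longrightarrow> (\<forall>v\<in>X. \<forall>w\<in>X. v \<noteq> w \<longrightarrow> (v, w) \<notin> S) \<longrightarrow> finite X \<and> card X \<le> N)"
  (is "_ \<longleftrightarrow> (\<exists>N. ?bounded N)")
proof
  assume "finite_index S T"
  then obtain N where N: "rel_index S T = enat N"
    unfolding finite_index_def by (cases "rel_index S T") auto
  have "?bounded N"
  proof (intro allI impI)
    fix u X assume "X \<subseteq> T `` {u}" "\<forall>v\<in>X. \<forall>w\<in>X. v \<noteq> w \<longrightarrow> (v, w) \<notin> S"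
    then have "ecard X \<le> rel_index S T"
      unfolding rel_index_def by (intro SUP_upper CollectI exI[of _ u] conjI)
    then show "finite X \<and> card X \<le> N"
      unfolding N ecard_def by (auto split: if_splits)
  qed
  then show "\<exists>N. ?bounded N" ..
next
  assume "\<exists>N. ?bounded N"
  then obtain N where "?bounded N" ..
  then have "rel_index S T \<le> enat N"
    unfolding rel_index_def by (intro SUP_least) (auto simp: ecard_def)
  then show "finite_index S T"
    unfolding finite_index_def by (rule le_less_trans) simp
qed

text \<open>Sending each element of an independent set to a point of \<open>F\<close> that covers it
  is injective: two elements with the same point would be related by \<open>S\<close>.\<close>

lemma finite_index_coverI:
  assumes "equiv V S"
    and cover: "\<And>u. \<exists>F. finite F \<and> card F \<le> N \<and> T `` {u} \<subseteq> S `` F"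
  shows "finite_index S T"
  unfolding finite_index_iff
proof (intro exI[of _ N] allI impI)
  fix u X assume X: "X \<subseteq> T `` {u}" and indep: "\<forall>v\<in>X. \<forall>w\<in>X. v \<noteq> w \<longrightarrow> (v, w) \<notin> S"
  obtain F where F: "finite F" "card F \<le> N" "T `` {u} \<subseteq> S `` F"
    using cover by blast
  then have "\<forall>x\<in>X. \<exists>y\<in>F. (y, x) \<in> S"
    using X by blast
  then obtain g where g: "\<And>x. x \<in> X \<Longrightarrow> g x \<in> F \<and> (g x, x) \<in> S"
    by metis
  have "inj_on g X"
    using g indep assms(1) by (intro inj_onI) (metis equivE symD transD)
  moreover have "g ` X \<subseteq> F"
    using g by blast
  ultimately show "finite X \<and> card X \<le> N"
    using F by (meson card_inj_on_le inj_on_finite le_trans)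
qed

text \<open>An independent set of greatest size is a cover, since an element it leaves uncovered
  could be added to it.\<close>

lemma finite_index_cover:
  assumes "equiv V S" and "T \<subseteq> V \<times> V" and "finite_index S T"
  shows "\<exists>N. \<forall>u. \<exists>F. finite F \<and> card F \<le> N \<and> F \<subseteq> T `` {u} \<and> T `` {u} \<subseteq> S `` F"
proof -
  define indep where "indep u X \<longleftrightarrow> X \<subseteq> T `` {u} \<and> (\<forall>v\<in>X. \<forall>w\<in>X. v \<noteq> w \<longrightarrow> (v, w) \<notin> S)" for u X
  obtain N where N: "\<forall>u X. indep u X \<longrightarrow> finite X \<and> card X \<le> N"
    using assms(3) unfolding finite_index_iff indep_def imp_conjL by (elim exE)
  have refl: "\<And>x. x \<in> V \<Longrightarrow> (x, x) \<in> S" and sym: "\<And>x y. (x, y) \<in> S \<Longrightarrow> (y, x) \<in> S"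
    using assms(1) by (auto simp: equiv_def refl_on_def sym_def)
  have "\<exists>F. finite F \<and> card F \<le> N \<and> F \<subseteq> T `` {u} \<and> T `` {u} \<subseteq> S `` F" for u
  proof -
    have "indep u {}" by (simp add: indep_def)
    moreover have "\<forall>X. indep u X \<longrightarrow> card X < Suc N"
      using N le_imp_less_Suc by blast
    ultimately have "\<exists>X. indep u X \<and> (\<forall>Y. indep u Y \<longrightarrow> card Y \<le> card X)"
      by (rule ex_has_greatest_nat)
    then obtain X where X: "indep u X" and max: "\<And>Y. indep u Y \<Longrightarrow> card Y \<le> card X"
      by meson
    have fin: "finite X" "card X \<le> N"
      using N X by blast+
    have "T `` {u} \<subseteq> S `` X"
    proof (rule subsetI, rule ccontr)
      fix v assume v: "v \<in> T `` {u}" "v \<notin> S `` X"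
      moreover have "v \<in> V" using v(1) assms(2) by blast
      ultimately have "v \<notin> X" using refl by blast
      have "(x, y) \<notin> S" if "x \<in> insert v X" "y \<in> insert v X" "x \<noteq> y" for x y
        using that v(2) sym X unfolding indep_def by (metis ImageI insertE)
      then have "indep u (insert v X)"
        using X v(1) unfolding indep_def by simp
      then show False
        using max[of "insert v X"] \<open>v \<notin> X\<close> fin(1) by simp
    qed
    moreover have "X \<subseteq> T `` {u}"
      using X by (simp add: indep_def)
    ultimately show ?thesis
      using fin by metis
  qed
  then show ?thesis by (intro exI[of _ N] allI)
qed

lemma finite_index_mono:
  assumes "finite_index S T" "S \<subseteq> S'" "T' \<subseteq> T"
  shows "finite_index S' T'"
proof -
  have "X \<subseteq> T' `` {u} \<Longrightarrow> X \<subseteq> T `` {u}" for u X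
    using assms(3) by blast
  then show ?thesis
    using assms(1,2) unfolding finite_index_iff by (meson subsetD)
qed

text \<open>Cover the \<open>T\<close>-image by \<open>Q\<close>-classes of at most \<open>N\<close>
  points. By \<open>Q O T' \<subseteq> T'\<close> only the \<open>T'\<close>-images of these points
  have to be covered, each by at most \<open>M\<close> points of its own.\<close>

lemma finite_index_relcomp:
  assumes "equiv V Q" "equiv V S" "T \<subseteq> V \<times> V" "T' \<subseteq> V \<times> V" "Q O T' \<subseteq> T'"
    and "finite_index Q T" "finite_index S T'"
  shows "finite_index S (T O T')"
proof -
  obtain N where N: "\<forall>u. \<exists>F. finite F \<and> card F \<le> N \<and> F \<subseteq> T `` {u} \<and> T `` {u} \<subseteq> Q `` F"
    using finite_index_cover[OF assms(1,3,6)] by (elim exE)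
  obtain M where "\<forall>u. \<exists>F. finite F \<and> card F \<le> M \<and> F \<subseteq> T' `` {u} \<and> T' `` {u} \<subseteq> S `` F"
    using finite_index_cover[OF assms(2,4,7)] by (elim exE)
  then obtain G where G: "\<And>u. finite (G u)" "\<And>u. card (G u) \<le> M" "\<And>u. T' `` {u} \<subseteq> S `` G u"
    by metis
  show ?thesis
  proof (rule finite_index_coverI[OF assms(2)])
    fix u
    obtain F where F: "finite F" "card F \<le> N" "T `` {u} \<subseteq> Q `` F"
      using N by metis
    have "card (\<Union>x\<in>F. G x) \<le> (\<Sum>x\<in>F. card (G x))"
      using F(1) by (rule card_UN_le)
    also have "\<dots> \<le> card F * M"
      using G(2) sum_bounded_above[of F "\<lambda>x. card (G x)" M] by simp
    also have "\<dots> \<le> N * M"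
      using F(2) by simp
    finally have "card (\<Union>x\<in>F. G x) \<le> N * M" .
    moreover have "(T O T') `` {u} \<subseteq> S `` (\<Union>x\<in>F. G x)"
    proof
      fix y assume "y \<in> (T O T') `` {u}"
      then obtain x where x: "(u, x) \<in> T" "(x, y) \<in> T'" by blast
      then obtain z where z: "z \<in> F" "(z, x) \<in> Q" using F(3) by blast
      then have "(z, y) \<in> T'" using x(2) assms(5) by blast
      then show "y \<in> S `` (\<Union>x\<in>F. G x)" using G(3)[of z] z(1) by blast
    qed
    ultimately show "\<exists>F. finite F \<and> card F \<le> N * M \<and> (T O T') `` {u} \<subseteq> S `` F"
      using F(1) G(1) by (intro exI[of _ "\<Union>x\<in>F. G x"]) simp
  qed
qed

section \<open>Sequential transducers\<close>

lemma path_snoc: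
  assumes "path T p u v q" "(q, (x, y), r) \<in> transitions T" "r \<in> states T"
  shows "path T p (u @ x) (v @ y) r"
  using assms
proof (induction rule: path.induct)
  case (path_Nil p)
  then show ?case using path_Cons[OF path_Nil(2) path.path_Nil[OF path_Nil(3)]] by simp
next
  case (path_Cons p x' y' q u v r')
  then show ?case using path.path_Cons[OF path_Cons(1)] by fastforce
qed

lemma path_in_lists:
  assumes "path T p u v q" "finite_transducer A B T"
  shows "u \<in> lists A" "v \<in> lists B" "p \<in> states T" "q \<in> states T"
  using assms by (induction rule: path.induct) (auto simp: finite_transducer_def)

lemma sequential_path_unique:
  assumes "path T p u v q" "path T p u v' q'" "sequential A B T"
  shows "v = v' \<and> q = q'"
  using assms
proof (induction arbitrary: v' q' rule: path.induct)
  case (path_Nil p)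
  from path_Nil(2) show ?case
    using path_Nil(3) by cases (auto simp: sequential_def)
next
  case (path_Cons p x y q u v r)
  obtain a where a: "x = [a]"
    using path_Cons.hyps(1) path_Cons.prems(2) by (auto simp: sequential_def)
  from path_Cons.prems(1) show ?case
  proof cases
    case path_Nil
    then show ?thesis using a by simp
  next
    case (path_Cons x' y' q1 u' v1)
    obtain a' where a': "x' = [a']"
      using path_Cons(3) assms(3) by (auto simp: sequential_def)
    have "a' = a" "u' = u" using path_Cons a a' by auto
    then have "y' = y \<and> q1 = q"
      using \<open>(p, (x, y), q) \<in> transitions T\<close> path_Cons(3) assms(3) a a'
      unfolding sequential_def by blast
    then show ?thesis
      using path_Cons path_Cons.IH[of v1 q'] \<open>u' = u\<close> assms(3) by auto
  qed
qed

lemma sequential_path_split: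
  assumes "path T p x z r" "x = u @ w" "sequential A B T" "finite_transducer A B T"
  shows "\<exists>y y' q. z = y @ y' \<and> path T p u y q \<and> path T q w y' r"
  using assms
proof (induction arbitrary: u rule: path.induct)
  case (path_Nil p)
  then show ?case by (auto intro: path.path_Nil)
next
  case (path_Cons p x y q u' v r)
  obtain a where a: "x = [a]"
    using path_Cons.hyps(1) path_Cons.prems(2) by (auto simp: sequential_def)
  show ?case
  proof (cases u)
    case Nil
    have "p \<in> states T"
      using path_Cons.hyps(1) path_Cons.prems(3) by (auto simp: finite_transducer_def)
    then have "path T p u [] p" using Nil by (auto intro: path.path_Nil)
    moreover have "path T p w (y @ v) r"
      using path.path_Cons[OF path_Cons.hyps] path_Cons.prems(1) Nil by simp
    ultimately show ?thesis by fastforce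
  next
    case (Cons b u1)
    then have "b = a" "u' = u1 @ w" using path_Cons.prems(1) a by auto
    then obtain z1 z2 q1 where "v = z1 @ z2" "path T q u1 z1 q1" "path T q1 w z2 r"
      using path_Cons.IH path_Cons.prems by blast
    moreover from this have "path T p u (y @ z1) q1"
      using path.path_Cons[OF path_Cons.hyps(1)] Cons a \<open>b = a\<close> by fastforce
    ultimately show ?thesis by (metis append.assoc)
  qed
qed

text \<open>By determinism the path on \<open>u\<close> is unique, so the output on a further word
  depends only on the state reached. This replaces the transducer by two functions.\<close>

lemma sequential_residual:
  assumes T: "finite_transducer A B T" and seq: "sequential A B T"
    and real: "realized_rel T = {(u, f u) | u. u \<in> lists A}"
  obtains st out where "\<And>u. u \<in> lists A \<Longrightarrow> st u \<in> states T"
    and "\<And>u w. u \<in> lists A \<Longrightarrow> w \<in> lists A \<Longrightarrow> f (u @ w) = f u @ out (st u) w"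
    and "\<And>u. u \<in> lists A \<Longrightarrow> f u \<in> lists B"
proof -
  obtain i where i: "initial_states T = {i}"
    using seq by (auto simp: sequential_def)
  have ex: "\<exists>q. path T i u (f u) q" if "u \<in> lists A" for u
  proof -
    have "(u, f u) \<in> realized_rel T" using that real by blast
    then show ?thesis using i by (auto simp: realized_rel_def)
  qed
  define st where "st u = (SOME q. path T i u (f u) q)" for u
  have st: "path T i u (f u) (st u)" if "u \<in> lists A" for u
    unfolding st_def using ex[OF that] by (rule someI_ex)
  define out where "out p w = (SOME y. \<exists>r. path T p w y r)" for p w
  have out: "out p w = y" if "path T p w y r" for p w y r
    unfolding out_def using that sequential_path_unique[OF _ _ seq] by (intro some_equality) blast+
  show ?thesis
  proof (rule that[of st out])
    show "st u \<in> states T" "f u \<in> lists B" if "u \<in> lists A" for u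
      using path_in_lists[OF st[OF that] T] by auto
    show "f (u @ w) = f u @ out (st u) w" if "u \<in> lists A" "w \<in> lists A" for u w
    proof -
      have "path T i (u @ w) (f (u @ w)) (st (u @ w))"
        using that by (intro st) auto
      then obtain y y' q where *: "f (u @ w) = y @ y'" "path T i u y q" "path T q w y' (st (u @ w))"
        using sequential_path_split[OF _ refl seq T] by blast
      then have "y = f u" "q = st u"
        using sequential_path_unique[OF *(2) st[OF that(1)] seq] by auto
      then show ?thesis using * out by auto
    qed
  qed
qed

text \<open>The converse packaging: an automaton on any finite \<open>Q\<close> is renamed into
  \<open>nat\<close>, and all states are final, so that the realized function is total.\<close>

lemma KerSeqI:
  fixes A :: "'a set" and st :: "'a list \<Rightarrow> 'q" and f :: "'a list \<Rightarrow> nat list"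
  assumes "finite A" "finite Q" and st: "\<And>u. u \<in> lists A \<Longrightarrow> st u \<in> Q"
    and step: "\<And>u a. u \<in> lists A \<Longrightarrow> a \<in> A \<Longrightarrow> st (u @ [a]) = \<delta> (st u) a"
    and closed: "\<And>q a. q \<in> Q \<Longrightarrow> a \<in> A \<Longrightarrow> \<delta> q a \<in> Q"
    and f_Nil: "f [] = []"
    and f_snoc: "\<And>u a. u \<in> lists A \<Longrightarrow> a \<in> A \<Longrightarrow> f (u @ [a]) = f u @ out (st u) a"
  shows "kernel_on A f \<in> KerSeq"
proof -
  obtain e :: "'q \<Rightarrow> nat" where e: "inj_on e Q"
    using finite_imp_inj_to_nat_seg[OF \<open>finite Q\<close>] by blast
  define B where "B = (\<Union>p\<in>Q. \<Union>a\<in>A. set (out p a))"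
  define tr where "tr = (\<lambda>(p, a). (e p, ([a], out p a), e (\<delta> p a))) ` (Q \<times> A)"
  define T :: "(nat, 'a, nat) transducer" where
    "T = \<lparr>states = e ` Q, transitions = tr, initial_states = {e (st [])}, final_states = e ` Q\<rparr>"
  have B: "finite B"
    unfolding B_def using assms(1,2) by auto
  have init: "st [] \<in> Q" using st by auto
  have T: "finite_transducer A B T"
    unfolding finite_transducer_def T_def tr_def B_def using assms(1,2) closed init by auto
  have seq: "sequential A B T"
    unfolding sequential_def T_def tr_def B_def using inj_onD[OF e] by auto
  have path: "u \<in> lists A \<Longrightarrow> path T (e (st [])) u (f u) (e (st u))" for u
  proof (induction u rule: rev_induct)
    case Nil
    then show ?case using init by (auto simp: f_Nil T_def intro: path_Nil)
  next
    case (snoc a u)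
    then have a: "a \<in> A" "u \<in> lists A" by auto
    then have "(e (st u), ([a], out (st u) a), e (st (u @ [a]))) \<in> transitions T"
      using st[OF a(2)] step[OF a(2,1)] by (force simp: T_def tr_def)
    moreover have "e (st (u @ [a])) \<in> states T"
      using st[of "u @ [a]"] a by (simp add: T_def)
    ultimately show ?case
      using path_snoc[OF snoc.IH[OF a(2)]] f_snoc[OF a(2,1)] by metis
  qed
  have "realized_rel T = {(u, f u) | u. u \<in> lists A}"
  proof (intro equalityI subsetI)
    fix x assume "x \<in> realized_rel T"
    then obtain u v q where x: "x = (u, v)" "path T (e (st [])) u v q"
      by (auto simp: realized_rel_def T_def)
    moreover have "u \<in> lists A" using path_in_lists[OF x(2) T] by simp
    ultimately show "x \<in> {(u, f u) | u. u \<in> lists A}"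
      using sequential_path_unique[OF x(2) path seq] by auto
  next
    fix x assume "x \<in> {(u, f u) | u. u \<in> lists A}"
    then show "x \<in> realized_rel T"
      using path st by (force simp: realized_rel_def T_def)
  qed
  then show ?thesis
    unfolding KerSeq_def using \<open>finite A\<close> B T seq by blast
qed

section \<open>Letter-to-letter transducers\<close>

lemma letter_to_letter_path_split:
  assumes "path T p x y r" "letter_to_letter A B T" "finite_transducer A B T"
    and "x = u @ w" "y = v @ w'" "length u = length v"
  shows "\<exists>q. path T p u v q \<and> path T q w w' r"
  using assms
proof (induction arbitrary: u v rule: path.induct)
  case (path_Nil p)
  then show ?case by (auto intro: path.path_Nil)
next
  case (path_Cons p x y q x' y' r)
  obtain a b where ab: "x = [a]" "y = [b]"
    using path_Cons.hyps(1) path_Cons.prems(1) by (auto simp: letter_to_letter_def)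
  show ?case
  proof (cases u)
    case Nil
    have "p \<in> states T"
      using path_Cons.hyps(1) path_Cons.prems(2) by (auto simp: finite_transducer_def)
    then show ?thesis
      using Nil path.path_Cons[OF path_Cons.hyps] path_Cons.prems by (auto intro!: exI[of _ p] path.path_Nil)
  next
    case (Cons c u1)
    then obtain d v1 where v: "v = d # v1"
      using path_Cons.prems by (cases v) auto
    then obtain q1 where "path T q u1 v1 q1" "path T q1 w w' r"
      using path_Cons.IH[of u1 v1] path_Cons.prems Cons ab by auto
    moreover from this have "path T p u v q1"
      using path.path_Cons[OF path_Cons.hyps(1)] Cons v ab path_Cons.prems(3,4) by fastforce
    ultimately show ?thesis by blast
  qed
qed

lemma path_append:
  assumes "path T p u v q" "path T q w w' r"
  shows "path T p (u @ w) (v @ w') r"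
  using assms by (induction rule: path.induct) (auto intro: path.path_Cons)

lemma letter_to_letter_length:
  assumes "path T p u v q" "letter_to_letter A B T"
  shows "length u = length v"
  using assms by (induction rule: path.induct) (auto simp: letter_to_letter_def)

text \<open>A path can be cut after any pair of prefixes of equal length, so a residual is
  determined by the set of states that the pair reaches. There are finitely many such sets.\<close>

lemma finite_residuals:
  assumes "letter_to_letter A B T" "finite_transducer A B T"
  shows "finite ((\<lambda>(u, v). {(w, w'). (u @ w, v @ w') \<in> realized_rel T}) ` {(u, v). length u = length v})"
    (is "finite (?res ` _)")
proof (rule finite_subset)
  define from_states where
    "from_states X = {(w, w'). \<exists>q\<in>X. \<exists>r\<in>final_states T. path T q w w' r}" for X
  define reached where "reached u v = {q. \<exists>p\<in>initial_states T. path T p u v q}" for u v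
  show "finite (from_states ` Pow (states T))"
    using assms(2) by (simp add: finite_transducer_def)
  have "(u @ w, v @ w') \<in> realized_rel T \<longleftrightarrow> (w, w') \<in> from_states (reached u v)"
    if len: "length u = length v" for u v w w'
  proof
    assume "(u @ w, v @ w') \<in> realized_rel T"
    then obtain p r where "p \<in> initial_states T" "r \<in> final_states T" "path T p (u @ w) (v @ w') r"
      by (auto simp: realized_rel_def)
    moreover from this obtain q where "path T p u v q" "path T q w w' r"
      using letter_to_letter_path_split[OF _ assms refl refl len] by metis
    ultimately show "(w, w') \<in> from_states (reached u v)"
      unfolding from_states_def reached_def by auto
  next
    assume "(w, w') \<in> from_states (reached u v)"
    then show "(u @ w, v @ w') \<in> realized_rel T"
      using path_append[of T _ u v _ w w'] unfolding from_states_def reached_def realized_rel_def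
      by blast
  qed
  then have "?res (u, v) = from_states (reached u v)" if "length u = length v" for u v
    using that by auto
  moreover have "reached u v \<in> Pow (states T)" for u v
    using path_in_lists(4)[OF _ assms(2)] unfolding reached_def by auto
  ultimately show "?res ` {(u, v). length u = length v} \<subseteq> from_states ` Pow (states T)"
    by auto
qed

section \<open>Length-preserving equivalence relations\<close>

locale length_preserving_equiv =
  fixes A :: "'a set" and R :: "'a list rel"
  assumes finite_A: "finite A" and equiv_R: "equiv (lists A) R"
    and R_length: "(u, v) \<in> R \<Longrightarrow> length u = length v"
begin

abbreviation "S \<equiv> syntactic_congruence A R"
abbreviation "P \<equiv> prefix_closure A R"
abbreviation "E \<equiv> P\<^sup>+"

lemma R_lists: "(u, v) \<in> R \<Longrightarrow> u \<in> lists A \<and> v \<in> lists A"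
  using subsetD[OF equiv_type[OF equiv_R], of "(u, v)"] by simp

lemma R_refl: "u \<in> lists A \<Longrightarrow> (u, u) \<in> R"
  using equiv_class_self[OF equiv_R] by simp

lemma R_sym: "(u, v) \<in> R \<Longrightarrow> (v, u) \<in> R"
  using equiv_R by (elim equivE) (rule symD)

lemma R_trans: "(u, v) \<in> R \<Longrightarrow> (v, w) \<in> R \<Longrightarrow> (u, w) \<in> R"
  using equiv_R by (elim equivE) (rule transD)

section \<open>The syntactic congruence\<close>

lemma S_lists: "(u, v) \<in> S \<Longrightarrow> u \<in> lists A \<and> v \<in> lists A"
  by (simp add: syntactic_congruence_def)

lemma S_appendR: "(u, v) \<in> S \<Longrightarrow> w \<in> lists A \<Longrightarrow> (u @ w, v @ w) \<in> R"
  by (simp add: syntactic_congruence_def)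

lemma S_I: "u \<in> lists A \<Longrightarrow> v \<in> lists A \<Longrightarrow> (\<And>w. w \<in> lists A \<Longrightarrow> (u @ w, v @ w) \<in> R) \<Longrightarrow> (u, v) \<in> S"
  by (simp add: syntactic_congruence_def)

lemma S_refl: "u \<in> lists A \<Longrightarrow> (u, u) \<in> S"
  by (rule S_I) (simp_all add: R_refl)

lemma S_sym: "(u, v) \<in> S \<Longrightarrow> (v, u) \<in> S"
  unfolding syntactic_congruence_def using R_sym by blast

lemma S_trans:
  assumes "(u, v) \<in> S" "(v, w) \<in> S" shows "(u, w) \<in> S"
proof (rule S_I)
  show "(u @ x, w @ x) \<in> R" if "x \<in> lists A" for x
    by (rule R_trans[OF S_appendR[OF assms(1) that] S_appendR[OF assms(2) that]])
qed (use S_lists[OF assms(1)] S_lists[OF assms(2)] in simp_all)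

lemma S_append:
  assumes "(u, v) \<in> S" "w \<in> lists A" shows "(u @ w, v @ w) \<in> S"
proof (rule S_I)
  show "u @ w \<in> lists A" "v @ w \<in> lists A"
    using S_lists[OF assms(1)] assms(2) by auto
  show "((u @ w) @ x, (v @ w) @ x) \<in> R" if "x \<in> lists A" for x
    using S_appendR[OF assms(1), of "w @ x"] assms(2) that by simp
qed

lemma S_subset_R: "S \<subseteq> R"
proof
  fix x assume "x \<in> S"
  then show "x \<in> R"
    using S_appendR[of "fst x" "snd x" "[]"] by simp
qed

lemma equiv_S: "equiv (lists A) S"
proof (rule equivI)
  show "refl_on (lists A) S"
    using S_refl by (simp add: refl_on_def)
  show "S \<subseteq> lists A \<times> lists A"
    using S_lists by (intro subrelI) blast
  show "sym S" "trans S"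
    by (intro symI transI; erule S_sym S_trans; assumption?)+
qed

section \<open>The prefix closure\<close>

lemma P_iff: "(u, v) \<in> P \<longleftrightarrow> (\<exists>u' v'. length u' = length v' \<and> (u @ u', v @ v') \<in> R)"
proof
  assume "\<exists>u' v'. length u' = length v' \<and> (u @ u', v @ v') \<in> R"
  then obtain u' v' where uv: "length u' = length v'" "(u @ u', v @ v') \<in> R"
    by blast
  then show "(u, v) \<in> P"
    using R_lists[OF uv(2)] unfolding prefix_closure_def by auto
qed (auto simp: prefix_closure_def)

lemma P_lists: "(u, v) \<in> P \<Longrightarrow> u \<in> lists A \<and> v \<in> lists A"
  by (auto simp: prefix_closure_def)

lemma P_length: "(u, v) \<in> P \<Longrightarrow> length u = length v"
  unfolding P_iff using R_length length_append add_right_cancel by metis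

lemma R_subset_P: "R \<subseteq> P"
proof (rule subrelI)
  show "(u, v) \<in> P" if "(u, v) \<in> R" for u v
    using that unfolding P_iff by (intro exI[of _ "[]"]) simp
qed

lemma P_refl: "u \<in> lists A \<Longrightarrow> (u, u) \<in> P"
  using R_subset_P R_refl by blast

lemma P_sym: "(u, v) \<in> P \<Longrightarrow> (v, u) \<in> P"
  unfolding P_iff by (metis R_sym)

text \<open>The extensions witnessing \<open>P\<close> stay the same: appending them to words
  related by \<open>S\<close> gives words related by \<open>R\<close>. Thus \<open>P\<close> is a
  relation between \<open>S\<close>-classes.\<close>

lemma P_S:
  assumes "(x, y) \<in> S" "(y, z) \<in> P" "(z, w) \<in> S"
  shows "(x, w) \<in> P"
proof -
  obtain u v where uv: "length u = length v" "(y @ u, z @ v) \<in> R"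
    using assms(2) unfolding P_iff by blast
  then have "u \<in> lists A" "v \<in> lists A"
    using R_lists[OF uv(2)] by simp_all
  then have "(x @ u, w @ v) \<in> R"
    using S_appendR[OF assms(1)] S_appendR[OF assms(3)] uv(2) R_trans by metis
  then show ?thesis
    unfolding P_iff using uv(1) by blast
qed

text \<open>The parts cut off are put in front of the witnesses. They have equal length because
  \<open>P\<close> preserves length.\<close>

lemma P_take:
  assumes "(u, v) \<in> P" shows "(take n u, take n v) \<in> P"
proof -
  obtain u' v' where "length u' = length v'" "(u @ u', v @ v') \<in> R"
    using assms unfolding P_iff by blast
  then have "length (drop n u @ u') = length (drop n v @ v')"
    "(take n u @ drop n u @ u', take n v @ drop n v @ v') \<in> R"
    using P_length[OF assms] by (simp_all add: append.assoc[symmetric] del: append.assoc)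
  then show ?thesis
    unfolding P_iff by blast
qed

section \<open>The transitive closure of the prefix closure\<close>

lemma R_subset_E: "R \<subseteq> E"
  using R_subset_P by auto

lemma E_lists: "(u, v) \<in> E \<Longrightarrow> u \<in> lists A \<and> v \<in> lists A"
  by (induction rule: trancl_induct) (use P_lists in meson)+

lemma equiv_E: "equiv (lists A) E"
proof (rule equivI)
  show "refl_on (lists A) E"
    using P_refl by (simp add: refl_on_def r_into_trancl)
  show "E \<subseteq> lists A \<times> lists A"
    using E_lists by (intro subrelI) blast
  show "sym E" by (meson P_sym sym_trancl symI)
qed simp

lemma E_refl: "u \<in> lists A \<Longrightarrow> (u, u) \<in> E"
  using P_refl by (simp add: r_into_trancl)

lemma E_sym: "(u, v) \<in> E \<Longrightarrow> (v, u) \<in> E"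
  using equiv_E unfolding equiv_def by (meson symD)

lemma E_length: "(u, v) \<in> E \<Longrightarrow> length u = length v"
  by (induction rule: trancl_induct) (simp_all add: P_length)

lemma E_take: "(u, v) \<in> E \<Longrightarrow> (take n u, take n v) \<in> E"
  by (induction rule: trancl_induct) (meson P_take r_into_trancl trancl_into_trancl)+

lemma E_prefix: "(u @ w, v @ w') \<in> E \<Longrightarrow> length u = length v \<Longrightarrow> (u, v) \<in> E"
  using E_take[of "u @ w" "v @ w'" "length u"] by simp

lemma E_Image_eq: "(u, v) \<in> E \<Longrightarrow> E `` {u} = E `` {v}"
  by (meson equiv_E equiv_class_eq)

section \<open>Stabilization of the powers of the prefix closure\<close>

text \<open>Reflexivity of \<open>R\<close> gives \<open>Q \<subseteq> Q O R\<close>, so the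
  composition bound applies with the \<open>R\<close>-classes as intermediate cover.\<close>

lemma finite_index_S_trans:
  assumes "finite_index S R" "finite_index R Q" "Q \<subseteq> lists A \<times> lists A"
  shows "finite_index S Q"
proof (rule finite_index_mono)
  have "R O R \<subseteq> R"
    by (auto intro: R_trans)
  then show "finite_index S (Q O R)"
    using finite_index_relcomp[OF equiv_R equiv_S assms(3) equiv_type[OF equiv_R]] assms(1,2) by metis
  show "Q \<subseteq> Q O R"
    using assms(3) R_refl by blast
qed simp

lemma finite_index_S_E_iff: "finite_index S E \<longleftrightarrow> finite_index S R \<and> finite_index R E"
proof
  assume "finite_index S E"
  then show "finite_index S R \<and> finite_index R E"
    using finite_index_mono S_subset_R R_subset_E by (metis order_refl)
next
  assume "finite_index S R \<and> finite_index R E"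
  then show "finite_index S E"
    using finite_index_S_trans equiv_type[OF equiv_E] by metis
qed

text \<open>A chain is padded by reflexive steps at its end. Exponents are positive because the
  power 0 also relates words outside \<open>lists A\<close>, where \<open>P\<close> is not
  reflexive.\<close>

lemma P_relpow_mono: "m \<le> n \<Longrightarrow> (u, v) \<in> P ^^ Suc m \<Longrightarrow> (u, v) \<in> P ^^ Suc n"
proof (induction n rule: dec_induct)
  case (step n)
  then have "(u, v) \<in> P ^^ Suc n" by simp
  moreover from this have "(v, v) \<in> P"
    using P_lists P_refl by (meson relpow_Suc_E)
  ultimately show ?case by (rule relpow_Suc_I)
qed

lemma relpow_subset_E: "P ^^ Suc n \<subseteq> E"
  unfolding trancl_power by (rule subsetI) (use trancl_power in blast)

lemma finite_index_S_relpow: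
  assumes "finite_index S P"
  shows "finite_index S (P ^^ Suc n)"
proof (induction n)
  case 0
  then show ?case using assms by simp
next
  case (Suc n)
  have "S O P \<subseteq> P"
    using P_S S_refl P_lists by blast
  moreover have "P ^^ Suc n \<subseteq> lists A \<times> lists A"
    using relpow_subset_E equiv_type[OF equiv_E] by (rule subset_trans)
  moreover have "P \<subseteq> lists A \<times> lists A"
    by (rule subrelI) (simp add: P_lists)
  ultimately have "finite_index S (P ^^ Suc n O P)"
    using finite_index_relcomp[OF equiv_S equiv_S] Suc assms by metis
  then show ?case by simp
qed

text \<open>Once two successive powers agree, all later ones agree too, so \<open>E\<close> lies in
  a single power of \<open>P\<close>, where composition bounds the index.\<close>

lemma finite_index_S_E_if_stable:
  assumes "finite_index S P" "1 \<le> k" "P ^^ k = P ^^ Suc k"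
  shows "finite_index S E"
proof -
  obtain n where n: "k = Suc n"
    using assms(2) by (cases k) auto
  have stable: "P ^^ Suc (n + d) = P ^^ k" for d
  proof (induction d)
    case (Suc d)
    have "P ^^ Suc (n + Suc d) = P ^^ Suc (n + d) O P" by simp
    also have "\<dots> = P ^^ k" unfolding Suc.IH using assms(3)[symmetric] unfolding relpow.simps .
    finally show ?case .
  qed (simp add: n)
  have "E \<subseteq> P ^^ k"
  proof (rule subrelI)
    fix u v assume "(u, v) \<in> E"
    then obtain m where "(u, v) \<in> P ^^ Suc m"
      unfolding trancl_power by (metis gr0_implies_Suc)
    then show "(u, v) \<in> P ^^ k"
      using P_relpow_mono[of m "n + m" u v] stable[of m] by simp
  qed
  then show ?thesis
    using finite_index_mono[OF finite_index_S_relpow[OF assms(1), of n] order_refl] n by simp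
qed

lemma stable_if_finite_index_S_E:
  assumes "finite_index S E"
  shows "\<exists>k\<ge>1. P ^^ k = P ^^ Suc k"
proof -
  obtain N where N: "\<forall>u. \<exists>F. finite F \<and> card F \<le> N \<and> F \<subseteq> E `` {u} \<and> E `` {u} \<subseteq> S `` F"
    using finite_index_cover[OF equiv_S equiv_type[OF equiv_E] assms] by (elim exE)
  have E_relpow: "(u, v) \<in> P ^^ Suc (Suc (N * N))" if "(u, v) \<in> E" for u v
  proof -
    obtain F where F: "finite F" "card F \<le> N" "E `` {u} \<subseteq> S `` F"
      using N by metis
    have "\<forall>x. (u, x) \<in> E \<longrightarrow> (\<exists>a\<in>F. (a, x) \<in> S)"
      using F(3) by blast
    then obtain g where g: "\<And>x. (u, x) \<in> E \<Longrightarrow> g x \<in> F \<and> (g x, x) \<in> S"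
      by metis
    have u: "(u, u) \<in> E"
      using that E_lists E_refl by blast
    \<comment> \<open>The map \<open>g\<close> replaces each word of the class by a representative
      in \<open>F\<close> with the same \<open>S\<close>-class. By \<open>P_S\<close> it turns
      \<open>P\<close>-chains into \<open>Q\<close>-chains, and a chain in the finite relation
      \<open>Q\<close> can be shortened to at most \<open>card Q\<close> steps.\<close>
    define Q where "Q = P \<inter> F \<times> F"
    have Q: "(g x, g y) \<in> Q" if "(u, x) \<in> E" "(x, y) \<in> P" for x y
    proof -
      have "(u, y) \<in> E" using that by (rule trancl_into_trancl)
      then show ?thesis
        using g[OF that(1)] g[of y] P_S[OF _ that(2) S_sym, of "g x" "g y"] unfolding Q_def by blast
    qed
    have "(g u, g v) \<in> Q\<^sup>+"
      using that
    proof (induction rule: trancl_induct)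
      case (base y)
      then show ?case using Q[OF u] by blast
    next
      case (step y z)
      then show ?case using Q[of y z] by (meson trancl_into_trancl)
    qed
    moreover have "finite Q"
      unfolding Q_def using F(1) by blast
    ultimately obtain n where n: "n \<le> card Q" "(g u, g v) \<in> Q ^^ n"
      unfolding trancl_finite_eq_relpow[OF \<open>finite Q\<close>] by blast
    have "card Q \<le> card (F \<times> F)"
      unfolding Q_def using F(1) by (intro card_mono) auto
    also have "\<dots> \<le> N * N"
      using F(2) by (simp add: card_cartesian_product mult_le_mono)
    finally have "n \<le> N * N"
      using n(1) by simp
    have "Q ^^ i \<subseteq> P ^^ i" for i
      by (induction i) (auto simp: Q_def)
    then have "(g u, g v) \<in> P ^^ n"
      using n(2) by (rule subsetD)
    \<comment> \<open>One step at each end links the words to their representatives, which accounts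
      for the two successors in the exponent.\<close>
    moreover have "(u, g u) \<in> P" "(g v, v) \<in> P"
      using g[OF u] g[OF that] S_sym S_subset_R R_subset_P by blast+
    ultimately have "(u, v) \<in> P ^^ Suc (Suc n)"
      by (meson relpow_Suc_I relpow_Suc_I2)
    then show ?thesis
      using P_relpow_mono[of "Suc n" "Suc (N * N)"] \<open>n \<le> N * N\<close> by simp
  qed
  have "P ^^ Suc (Suc (N * N)) = P ^^ Suc (Suc (Suc (N * N)))"
  proof (intro equalityI subrelI)
    show "(u, v) \<in> P ^^ Suc (Suc (Suc (N * N)))" if "(u, v) \<in> P ^^ Suc (Suc (N * N))" for u v
      using that by (rule P_relpow_mono[rotated]) simp
    show "(u, v) \<in> P ^^ Suc (Suc (N * N))" if "(u, v) \<in> P ^^ Suc (Suc (Suc (N * N)))" for u v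
      using subsetD[OF relpow_subset_E that] by (rule E_relpow)
  qed
  then show ?thesis
    by (intro exI[of _ "Suc (Suc (N * N))"] conjI) simp_all
qed

lemma finite_index_iff_stable:
  "finite_index S R \<and> finite_index R E \<longleftrightarrow>
    finite_index S R \<and> finite_index R P \<and> (\<exists>k\<ge>1. P ^^ k = P ^^ Suc k)"
proof
  assume *: "finite_index S R \<and> finite_index R E"
  moreover have "finite_index R P"
    using * finite_index_mono[of R E R P] subrelI[of P E] r_into_trancl[of _ _ P] by simp
  ultimately show "finite_index S R \<and> finite_index R P \<and> (\<exists>k\<ge>1. P ^^ k = P ^^ Suc k)"
    using stable_if_finite_index_S_E finite_index_S_E_iff by blast
next
  assume *: "finite_index S R \<and> finite_index R P \<and> (\<exists>k\<ge>1. P ^^ k = P ^^ Suc k)"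
  then have "finite_index S P"
    using finite_index_S_trans[of P] P_lists subrelI[of P "lists A \<times> lists A"] by simp
  then show "finite_index S R \<and> finite_index R E"
    using * finite_index_S_E_if_stable finite_index_S_E_iff by blast
qed

end

section \<open>Kernels of sequential functions\<close>

text \<open>Otherwise the chain would cross the \<open>N + 1\<close> disjoint windows of width
  \<open>K\<close> starting at \<open>c x + k * K\<close> with \<open>k \<le> N\<close>. It cannot
  jump over a window, so \<open>c\<close> would take more than \<open>N\<close> values.\<close>

lemma bounded_by_gaps:
  fixes c :: "'b \<Rightarrow> nat"
  assumes "(x, y) \<in> r\<^sup>*" and gap: "\<And>a b. (x, a) \<in> r\<^sup>* \<Longrightarrow> (a, b) \<in> r \<Longrightarrow> c b \<le> c a + K"
    and "0 < K" and fin: "finite (c ` (r\<^sup>* `` {x}))" and card: "card (c ` (r\<^sup>* `` {x})) \<le> N"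
  shows "c y < c x + N * K"
proof (rule ccontr)
  assume "\<not> c y < c x + N * K"
  \<comment> \<open>The step at which the chain first reaches \<open>t\<close> starts below
    \<open>t\<close> and rises by at most \<open>K\<close>, so it lands in the window.\<close>
  have hit: "\<exists>a. (x, a) \<in> r\<^sup>* \<and> t \<le> c a \<and> c a < t + K" if "c x \<le> t" "t \<le> c y" for t
    using assms(1) that(2)
  proof (induction rule: rtrancl_induct)
    case base
    then show ?case using that(1) \<open>0 < K\<close> by (intro exI[of _ x]) simp
  next
    case (step a b)
    show ?case
    proof (cases "t \<le> c a")
      case False
      then have "c b < t + K" using gap[OF step.hyps] by simp
      moreover have "(x, b) \<in> r\<^sup>*" using step.hyps by (rule rtrancl_into_rtrancl)
      ultimately show ?thesis using step.prems by auto
    qed (rule step.IH)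
  qed
  have "k \<in> (\<lambda>j. (j - c x) div K) ` c ` (r\<^sup>* `` {x})" if "k \<le> N" for k
  proof -
    have "k * K \<le> N * K" using that by simp
    then have "c x + k * K \<le> c y" using \<open>\<not> c y < c x + N * K\<close> by linarith
    then obtain a where a: "(x, a) \<in> r\<^sup>*" "c x + k * K \<le> c a" "c a < c x + k * K + K"
      using hit[of "c x + k * K"] by auto
    have "(c a - c x) div K = k"
      using a(2,3) by (intro div_nat_eqI) (simp_all add: mult.commute)
    then show ?thesis using a(1) by auto
  qed
  then have "{..N} \<subseteq> (\<lambda>j. (j - c x) div K) ` c ` (r\<^sup>* `` {x})"
    by blast
  then have "card {..N} \<le> card ((\<lambda>j. (j - c x) div K) ` c ` (r\<^sup>* `` {x}))"
    using fin by (intro card_mono) simp_all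
  also have "\<dots> \<le> N"
    using card_image_le[OF fin] card by (rule le_trans)
  finally show False by simp
qed

text \<open>Besides preservation of length, the finiteness of the set of residuals is what the
  letter-to-letter transducer contributes.\<close>

locale synchronous_equiv = length_preserving_equiv +
  assumes finite_residuals_R:
    "finite ((\<lambda>(u, v). {(w, w'). (u @ w, v @ w') \<in> R}) ` {(u, v). length u = length v})"
begin

text \<open>The possible witnesses for a pair form its residual. Picking one witness from each of
  the finitely many nonempty residuals bounds their lengths.\<close>

lemma P_bounded_witness:
  obtains L where "\<And>u v. (u, v) \<in> P \<Longrightarrow>
    \<exists>w w'. length w = length w' \<and> length w \<le> L \<and> (u @ w, v @ w') \<in> R"
proof -
  define res where "res = (\<lambda>(u, v). {(w, w'). (u @ w, v @ w') \<in> R})"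
  define pick where "pick \<rho> = (SOME x. x \<in> \<rho>)" for \<rho> :: "('a list \<times> 'a list) set"
  have "finite ((\<lambda>\<rho>. length (fst (pick \<rho>))) ` res ` {(u, v). length u = length v})"
    using finite_residuals_R unfolding res_def by (rule finite_imageI)
  then obtain L where "\<forall>l\<in>(\<lambda>\<rho>. length (fst (pick \<rho>))) ` res ` {(u, v). length u = length v}. l \<le> L"
    unfolding finite_nat_set_iff_bounded_le by (elim exE)
  then have L: "length (fst (pick (res (u, v)))) \<le> L" if "length u = length v" for u v
    using that by blast
  show ?thesis
  proof (rule that)
    fix u v assume uv: "(u, v) \<in> P"
    then obtain x where "x \<in> res (u, v)"
      unfolding P_iff res_def by auto
    then have "pick (res (u, v)) \<in> res (u, v)"
      unfolding pick_def by (rule someI)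
    moreover obtain w w' where ww: "pick (res (u, v)) = (w, w')"
      by (cases "pick (res (u, v))")
    ultimately have R: "(u @ w, v @ w') \<in> R"
      by (simp add: res_def)
    then have "length w = length w'"
      using R_length[OF R] P_length[OF uv] by simp
    then show "\<exists>w w'. length w = length w' \<and> length w \<le> L \<and> (u @ w, v @ w') \<in> R"
      using R L[OF P_length[OF uv]] ww by (intro exI[of _ w] exI[of _ w']) simp
  qed
qed

end

locale sequential_kernel = synchronous_equiv A R for A :: "'a set" and R +
  fixes f :: "'a list \<Rightarrow> 'b list" and st :: "'a list \<Rightarrow> 'q" and out Q B
  assumes finite_Q: "finite Q" and finite_B: "finite B"
    and st: "u \<in> lists A \<Longrightarrow> st u \<in> Q"
    and f_append: "u \<in> lists A \<Longrightarrow> w \<in> lists A \<Longrightarrow> f (u @ w) = f u @ out (st u) w"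
    and f_lists: "u \<in> lists A \<Longrightarrow> f u \<in> lists B"
    and R_kernel: "R = kernel_on A f"
begin

lemma R_iff: "u \<in> lists A \<Longrightarrow> v \<in> lists A \<Longrightarrow> (u, v) \<in> R \<longleftrightarrow> f u = f v"
  by (simp add: R_kernel kernel_on_def)

text \<open>From a common state all further outputs agree, so equal images stay equal. Hence the
  number of states will bound the index of \<open>S\<close> in \<open>R\<close>.\<close>

lemma S_I_state:
  assumes "(u, v) \<in> R" "st u = st v" shows "(u, v) \<in> S"
proof (rule S_I)
  have uv: "u \<in> lists A" "v \<in> lists A"
    using R_lists[OF assms(1)] by simp_all
  then show "u \<in> lists A" "v \<in> lists A" .
  show "(u @ w, v @ w) \<in> R" if "w \<in> lists A" for w
    using uv that assms(1,2) f_append[OF uv(1) that] f_append[OF uv(2) that]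
      R_iff[of u v] R_iff[of "u @ w" "v @ w"] by simp
qed

lemma finite_index_S_R: "finite_index S R"
  unfolding finite_index_iff
proof (intro exI[of _ "card Q"] allI impI)
  fix u X assume X: "X \<subseteq> R `` {u}" and indep: "\<forall>v\<in>X. \<forall>w\<in>X. v \<noteq> w \<longrightarrow> (v, w) \<notin> S"
  have "inj_on st X"
  proof (rule inj_onI)
    fix v w assume "v \<in> X" "w \<in> X" "st v = st w"
    moreover from this have "(v, w) \<in> R"
      using X R_sym R_trans[of v u w] by auto
    ultimately show "v = w"
      using S_I_state indep by auto
  qed
  moreover have "st ` X \<subseteq> Q"
  proof (rule image_subsetI)
    fix x assume "x \<in> X"
    then have "(u, x) \<in> R" using X by auto
    then show "st x \<in> Q" using st R_lists by simp
  qed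
  ultimately show "finite X \<and> card X \<le> card Q"
    using finite_Q by (metis card_inj_on_le inj_on_finite)
qed

lemma f_prefix: "u \<in> lists A \<Longrightarrow> w \<in> lists A \<Longrightarrow> prefix (f u) (f (u @ w))"
  by (simp add: f_append)

text \<open>As \<open>R\<close> preserves length, no letter can have empty output.\<close>

lemma f_length_ge:
  assumes "u \<in> lists A" "w \<in> lists A"
  shows "length (f u) + length w \<le> length (f (u @ w))"
  using assms(2)
proof (induction w rule: rev_induct)
  case (snoc a w)
  then have w: "u @ w \<in> lists A" "[a] \<in> lists A" "(u @ w) @ [a] \<in> lists A"
    using assms(1) by simp_all
  have "f (u @ w) \<noteq> f ((u @ w) @ [a])"
    using R_length[of "u @ w" "(u @ w) @ [a]"] R_iff[OF w(1,3)] by auto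
  then have "length (f (u @ w)) < length (f ((u @ w) @ [a]))"
    using f_append[OF w(1,2)] by simp
  then show ?case using snoc by simp
qed simp

lemma f_length_bound:
  obtains C where "0 < C"
    and "\<And>u w. u \<in> lists A \<Longrightarrow> w \<in> lists A \<Longrightarrow> length (f (u @ w)) \<le> length (f u) + C * length w"
proof -
  have "finite ((\<lambda>(q, a). length (out q [a])) ` (Q \<times> A))"
    using finite_Q finite_A by simp
  then obtain C where "\<forall>l\<in>(\<lambda>(q, a). length (out q [a])) ` (Q \<times> A). l \<le> C"
    unfolding finite_nat_set_iff_bounded_le by (elim exE)
  then have C: "length (out q [a]) \<le> Suc C" if "q \<in> Q" "a \<in> A" for q a
    using that by fastforce
  have "length (f (u @ w)) \<le> length (f u) + Suc C * length w" if "u \<in> lists A" "w \<in> lists A" for u w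
    using that(2)
  proof (induction w rule: rev_induct)
    case (snoc a w)
    then have w: "u @ w \<in> lists A" "[a] \<in> lists A" "a \<in> A"
      using that(1) by simp_all
    have "length (f ((u @ w) @ [a])) \<le> length (f (u @ w)) + Suc C"
      using f_append[OF w(1,2)] C[OF st[OF w(1)] w(3)] by simp
    then show ?case using snoc by simp
  qed simp
  then show ?thesis using that[of "Suc C"] by blast
qed

text \<open>Short witnesses extend both words to a common image. Both images are prefixes of it, and
  it exceeds the image of \<open>u\<close> by at most \<open>C * L\<close> letters; the successor
  only makes the bound positive.\<close>

lemma P_f:
  obtains K where "0 < K"
    and "\<And>u v. (u, v) \<in> P \<Longrightarrow> length (f v) \<le> length (f u) + K"
    and "\<And>u v. (u, v) \<in> P \<Longrightarrow> prefix (f u) (f v) \<or> prefix (f v) (f u)"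
proof -
  obtain C where C: "0 < C"
    "\<And>u w. u \<in> lists A \<Longrightarrow> w \<in> lists A \<Longrightarrow> length (f (u @ w)) \<le> length (f u) + C * length w"
    using f_length_bound by blast
  obtain L where L: "\<And>u v. (u, v) \<in> P \<Longrightarrow>
      \<exists>w w'. length w = length w' \<and> length w \<le> L \<and> (u @ w, v @ w') \<in> R"
    using P_bounded_witness by blast
  have P: "length (f v) \<le> length (f u) + Suc (C * L) \<and> (prefix (f u) (f v) \<or> prefix (f v) (f u))"
    if uv: "(u, v) \<in> P" for u v
  proof -
    obtain w w' where w: "length w \<le> L" "(u @ w, v @ w') \<in> R"
      using L[OF uv] by auto
    have in_lists: "u \<in> lists A" "w \<in> lists A" "v \<in> lists A" "w' \<in> lists A" "f (u @ w) = f (v @ w')"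
      using R_lists[OF w(2)] R_iff[of "u @ w" "v @ w'"] w(2) by simp_all
    have pre: "prefix (f u) (f (u @ w))" "prefix (f v) (f (u @ w))"
      using in_lists f_prefix[of u w] f_prefix[of v w'] by simp_all
    have "length (f v) \<le> length (f (u @ w))"
      using pre(2) by (rule prefix_length_le)
    also have "\<dots> \<le> length (f u) + C * length w"
      by (rule C(2)[OF in_lists(1,2)])
    also have "C * length w \<le> Suc (C * L)"
      using w(1) by (simp add: le_SucI)
    finally show ?thesis
      using prefix_same_cases[OF pre] by simp
  qed
  show ?thesis
    by (rule that[of "Suc (C * L)"]) (use P in auto)
qed

lemma finite_index_R_E: "finite_index R E"
proof -
  obtain C where C: "0 < C"
    "\<And>u w. u \<in> lists A \<Longrightarrow> w \<in> lists A \<Longrightarrow> length (f (u @ w)) \<le> length (f u) + C * length w"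
    using f_length_bound by blast
  obtain K where K: "0 < K" "\<And>u v. (u, v) \<in> P \<Longrightarrow> length (f v) \<le> length (f u) + K"
    and comparable: "\<And>u v. (u, v) \<in> P \<Longrightarrow> prefix (f u) (f v) \<or> prefix (f v) (f u)"
    using P_f by blast
  \<comment> \<open>The possible continuations of \<open>W\<close>: at most \<open>C * K\<close>
    letters will follow a cut, each with at most \<open>C\<close> letters of output.\<close>
  define Z where "Z = {z. set z \<subseteq> B \<and> length z \<le> C * (C * K)}"
  have "finite Z"
    unfolding Z_def using finite_B by (rule finite_lists_length_le)
  have W: "\<exists>W. \<forall>u. (u0, u) \<in> E \<longrightarrow> (\<exists>z\<in>Z. f u = W @ z)" if u0: "u0 \<in> lists A" for u0
  proof -
    define n where "n = length u0"
    obtain m where m: "(u0, m) \<in> E" and m_min: "\<And>u. (u0, u) \<in> E \<Longrightarrow> length (f m) \<le> length (f u)"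
      using ex_has_least_nat[of "\<lambda>u. (u0, u) \<in> E" u0 "length \<circ> f"] E_refl[OF u0] by auto
    define W where "W = f m"
    have in_class: "u \<in> lists A" "length u = n" if "(u0, u) \<in> E" for u
      using that E_lists[OF that] E_length[OF that] n_def by simp_all
    \<comment> \<open>Successive images in a \<open>P\<close>-chain are comparable, and none is
      shorter than \<open>W\<close>, so \<open>W\<close> remains a prefix along the chain.\<close>
    have prefix_W: "prefix W (f u)" if "(m, u) \<in> E" for u
      using that
    proof (induction rule: trancl_induct)
      case (base u)
      then have "(u0, u) \<in> E" using m by simp
      then show ?case
        using comparable[OF base] m_min[of u] unfolding W_def by (metis prefix_length_prefix prefix_order.refl)
    next
      case (step u v)
      then have "(u0, v) \<in> E" using m by (meson trancl_into_trancl trancl_trans)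
      then show ?case
        using comparable[OF step.hyps(2)] step.IH m_min[of v] prefix_length_prefix[of W "f u" "f v"]
          prefix_order.trans[of W "f u" "f v"] unfolding W_def by blast
    qed
    \<comment> \<open>The last position at which the image is still inside \<open>W\<close>.
      Position 0 always qualifies, by \<open>f_Nil\<close>.\<close>
    define cut where "cut u = (GREATEST i. i \<le> n \<and> length (f (take i u)) \<le> length W)" for u
    have f_Nil: "length (f []) \<le> length W"
      using f_prefix[of "[]" m] in_class(1)[OF m] unfolding W_def by (simp add: prefix_length_le)
    have cut: "cut u \<le> n \<and> length (f (take (cut u) u)) \<le> length W" for u
      unfolding cut_def by (rule GreatestI_nat[of _ 0 n]) (use f_Nil in auto)
    have cut_max: "i \<le> cut u" if "i \<le> n" "length (f (take i u)) \<le> length W" for i u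
      unfolding cut_def by (rule Greatest_le_nat[of _ i n]) (use that in auto)
    have split: "take i u \<in> lists A" "drop i u \<in> lists A" if "(u0, u) \<in> E" for i u
      using in_class(1)[OF that] by (auto dest: in_set_takeD in_set_dropD)
    have class_m: "(m, u) \<in> E" if "(u0, u) \<in> E" for u
      using E_sym[OF m] that by (rule trancl_trans)
    have prefix_take: "prefix (f (take i u)) (f u)" if "(u0, u) \<in> E" for i u
      using f_prefix[OF split[OF that], of i i] by simp
    \<comment> \<open>The next letter leads beyond \<open>W\<close> but outputs at most
      \<open>C\<close> letters. If no letter is left, the image is already as long as
      \<open>W\<close>.\<close>
    have cut_lower: "length W < length (f (take (cut u) u)) + C" if u: "(u0, u) \<in> E" for u
    proof (cases "cut u < n")
      case True
      then have "length W < length (f (take (Suc (cut u)) u))"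
        using cut_max[of "Suc (cut u)" u] by (metis Suc_leI not_less not_less_eq_eq order_refl)
      moreover have "take (Suc (cut u)) u = take (cut u) u @ [u ! cut u]" "u ! cut u \<in> A"
        using True in_class[OF u] by (simp_all add: take_Suc_conv_app_nth in_listsD)
      ultimately show ?thesis
        using C(2)[OF split(1)[OF u], of "[u ! cut u]" "cut u"] by simp
    next
      case False
      then have "cut u = n" using cut[of u] by simp
      then show ?thesis
        using in_class(2)[OF u] prefix_length_le[OF prefix_W[OF class_m[OF u]]] C(1) by simp
    qed
    \<comment> \<open>Just after its cut, \<open>u\<close> has left \<open>W\<close>, and the image
      of \<open>v\<close> at that position is at most \<open>K\<close> shorter. Every letter outputs
      something, so \<open>K\<close> more letters of \<open>v\<close> exceed
      \<open>W\<close>.\<close>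
    have cut_gap: "cut v \<le> cut u + K" if u: "(u0, u) \<in> E" and uv: "(u, v) \<in> P" for u v
    proof (rule ccontr)
      assume "\<not> cut v \<le> cut u + K"
      define p where "p = Suc (cut u)"
      have v: "(u0, v) \<in> E" using u uv by (rule trancl_into_trancl)
      have p: "p \<le> n" "p + K \<le> cut v"
        using \<open>\<not> cut v \<le> cut u + K\<close> cut[of v] unfolding p_def by simp_all
      have "length W < length (f (take p u))"
        using cut_max[of p u] p(1) unfolding p_def by (metis not_less not_less_eq_eq order_refl)
      also have "\<dots> \<le> length (f (take p v)) + K"
        using K(2)[OF P_take[OF P_sym[OF uv]]] .
      also have "\<dots> \<le> length (f (take p v)) + length (drop p (take (cut v) v))"
        using p cut[of v] in_class(2)[OF v] by simp
      also have "\<dots> \<le> length (f (take p v @ drop p (take (cut v) v)))"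
        using split(1)[OF v] in_class(1)[OF v]
        by (intro f_length_ge) (auto dest!: in_set_dropD in_set_takeD)
      also have "take p v @ drop p (take (cut v) v) = take (cut v) v"
        using p(2) append_take_drop_id[of p "take (cut v) v"] by simp
      also have "length (f (take (cut v) v)) \<le> length W"
        using cut by simp
      finally show False by simp
    qed
    define h where "h u = length (f (take (cut u) u))" for u
    define Y where "Y = E `` {u0}"
    \<comment> \<open>Images at the cuts are prefixes of \<open>W\<close>, so those of equal length
      coincide. The words cut there are then related by \<open>R\<close>, hence equally
      long.\<close>
    have "\<exists>g. \<forall>u\<in>Y. cut u = g (h u)"
    proof -
      have "cut u = cut v" if "u \<in> Y" "v \<in> Y" "h u = h v" for u v
      proof -
        have uv: "(u0, u) \<in> E" "(u0, v) \<in> E" using that unfolding Y_def by simp_all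
        have "prefix (f (take (cut x) x)) W" if "(u0, x) \<in> E" for x
          using prefix_length_prefix[OF prefix_take[OF that] prefix_W[OF class_m[OF that]]] cut by simp
        then have "f (take (cut u) u) = f (take (cut v) v)"
          using uv that(3) unfolding h_def prefix_def by (metis append_eq_append_conv)
        then have "(take (cut u) u, take (cut v) v) \<in> R"
          using split(1)[OF uv(1)] split(1)[OF uv(2)] R_iff by blast
        then show ?thesis
          using R_length[of "take (cut u) u" "take (cut v) v"] cut[of u] cut[of v]
            in_class(2)[OF uv(1)] in_class(2)[OF uv(2)] by simp
      qed
      then have "\<forall>u\<in>Y. cut u = cut (SOME v. v \<in> Y \<and> h v = h u)"
        by (metis (mono_tags, lifting) someI)
      then show ?thesis by (rule exI[of _ "\<lambda>l. cut (SOME v. v \<in> Y \<and> h v = l)"])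
    qed
    then obtain g where g: "\<forall>u\<in>Y. cut u = g (h u)" ..
    \<comment> \<open>Image lengths at cuts lie among the \<open>C\<close> values up to
      \<open>length W\<close>, so there are at most \<open>C\<close> cut positions in the
      class.\<close>
    have "h ` Y \<subseteq> (\<lambda>i. length W - i) ` {..<C}"
    proof (rule image_subsetI)
      fix u assume "u \<in> Y"
      then have "h u \<le> length W" "length W < h u + C"
        using cut[of u] cut_lower[of u] unfolding Y_def h_def by simp_all
      then show "h u \<in> (\<lambda>i. length W - i) ` {..<C}"
        by (intro image_eqI[of _ _ "length W - h u"]) simp_all
    qed
    then have "cut ` Y \<subseteq> g ` (\<lambda>i. length W - i) ` {..<C}"
      using g by auto
    moreover have "card (g ` (\<lambda>i. length W - i) ` {..<C}) \<le> C"
      using card_image_le[of "(\<lambda>i. length W - i) ` {..<C}" g]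
        card_image_le[of "{..<C}" "\<lambda>i. length W - i"] by simp
    ultimately have cut_Y: "finite (cut ` Y)" "card (cut ` Y) \<le> C"
      by (meson card_mono finite_imageI finite_lessThan finite_subset le_trans)+
    have "f u \<in> (@) W ` Z" if u: "(u0, u) \<in> E" for u
    proof -
      have rtrancl: "(u, x) \<in> P\<^sup>* \<longleftrightarrow> x \<in> Y" for x
      proof
        assume "(u, x) \<in> P\<^sup>*"
        then show "x \<in> Y"
          using u unfolding Y_def by (simp add: trancl_rtrancl_trancl)
      next
        assume "x \<in> Y"
        then have "(u, x) \<in> E"
          using E_sym[OF u] unfolding Y_def by (auto intro: trancl_trans)
        then show "(u, x) \<in> P\<^sup>*" by (rule trancl_into_rtrancl)
      qed
      then have Y: "P\<^sup>* `` {u} = Y" by blast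
      \<comment> \<open>The chain leads from \<open>u\<close> to \<open>m\<close>, whose cut is at
        the very end because its image is \<open>W\<close>. This bounds the number of letters of
        \<open>u\<close> after its cut.\<close>
      have "cut m < cut u + C * K"
      proof (rule bounded_by_gaps[where r = P and x = u and y = m])
        show "(u, m) \<in> P\<^sup>*" using rtrancl m unfolding Y_def by simp
        show "cut b \<le> cut a + K" if "(u, a) \<in> P\<^sup>*" "(a, b) \<in> P" for a b
          using cut_gap[OF _ that(2)] that(1) unfolding rtrancl Y_def by simp
        show "finite (cut ` P\<^sup>* `` {u})" "card (cut ` P\<^sup>* `` {u}) \<le> C"
          using cut_Y unfolding Y .
      qed (rule K(1))
      moreover have "n \<le> cut m"
        using in_class(2)[OF m] by (intro cut_max) (simp_all add: W_def)
      ultimately have "n - cut u \<le> C * K" by simp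
      have "length (f u) \<le> length (f (take (cut u) u)) + C * length (drop (cut u) u)"
        using C(2)[OF split[OF u], of "cut u" "cut u"] by simp
      also have "\<dots> \<le> length W + C * (C * K)"
        using cut[of u] \<open>n - cut u \<le> C * K\<close> in_class(2)[OF u] by (intro add_mono mult_le_mono) simp_all
      finally have "length (f u) \<le> length W + C * (C * K)" .
      moreover obtain z where z: "f u = W @ z"
        using prefix_W[OF class_m[OF u]] unfolding prefix_def by blast
      moreover have "set z \<subseteq> B"
        using f_lists[OF in_class(1)[OF u]] z by auto
      ultimately show ?thesis
        unfolding Z_def by simp
    qed
    then show ?thesis by (intro exI[of _ W]) auto
  qed
  show ?thesis
    unfolding finite_index_iff
  proof (intro exI[of _ "card Z"] allI impI)
    fix u0 X assume X: "X \<subseteq> E `` {u0}" and indep: "\<forall>v\<in>X. \<forall>w\<in>X. v \<noteq> w \<longrightarrow> (v, w) \<notin> R"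
    show "finite X \<and> card X \<le> card Z"
    proof (cases "u0 \<in> lists A")
      case True
      then obtain W where "\<forall>u. (u0, u) \<in> E \<longrightarrow> (\<exists>z\<in>Z. f u = W @ z)"
        using W by blast
      then have W: "\<exists>z\<in>Z. f u = W @ z" if "u \<in> X" for u
        using that X by auto
      have "inj_on f X"
      proof (rule inj_onI)
        fix v w assume vw: "v \<in> X" "w \<in> X" "f v = f w"
        then have "(u0, v) \<in> E" "(u0, w) \<in> E" using X by auto
        then have "(v, w) \<in> R" using vw(3) E_lists R_iff by simp
        then show "v = w" using vw(1,2) indep by auto
      qed
      moreover have "f ` X \<subseteq> (@) W ` Z"
        using W by auto
      moreover have "finite ((@) W ` Z)" "card ((@) W ` Z) \<le> card Z"
        using \<open>finite Z\<close> by (simp_all add: card_image_le)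
      ultimately show ?thesis
        by (metis card_inj_on_le inj_on_finite le_trans)
    next
      case False
      then have "X = {}" using X E_lists by blast
      then show ?thesis by simp
    qed
  qed
qed

end

section \<open>Construction of a sequential function\<close>

context synchronous_equiv
begin

section \<open>Residuals and the simulation of classes\<close>

definition residual :: "'a list \<Rightarrow> 'a list \<Rightarrow> ('a list \<times> 'a list) set" where
  "residual u v = {(w, w'). (u @ w, v @ w') \<in> R}"

lemma residual_S:
  assumes "(u, u') \<in> S" "(v, v') \<in> S"
  shows "residual u v = residual u' v'"
proof -
  have "(x' @ w, y' @ w') \<in> R" if xy: "(x @ w, y @ w') \<in> R" and S: "(x, x') \<in> S" "(y, y') \<in> S"
    for x y x' y' w w'
  proof -
    have w: "w \<in> lists A" "w' \<in> lists A" using R_lists[OF xy] by simp_all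
    show ?thesis
      by (rule R_trans[OF R_sym[OF S_appendR[OF S(1) w(1)]] R_trans[OF xy S_appendR[OF S(2) w(2)]]])
  qed
  then show ?thesis
    using assms S_sym unfolding residual_def by blast
qed

lemma P_append_residual:
  assumes "length u = length v"
  shows "(u @ w, v @ w') \<in> P \<longleftrightarrow>
    (\<exists>z z'. length z = length z' \<and> (w @ z, w' @ z') \<in> residual u v)"
  unfolding P_iff residual_def by simp

lemma S_subset_E: "(u, v) \<in> S \<Longrightarrow> (u, v) \<in> E"
  using S_subset_R R_subset_E by blast

text \<open>Up to \<open>S\<close>, an \<open>E\<close>-class is a finite list of words, and the residuals of these words
  form one of finitely many matrices. Classes with the same matrix look alike to \<open>R\<close>, to \<open>P\<close>
  and hence to \<open>E\<close>, so \<open>\<rho>\<close> may move all words of a class to a fixed class with the same matrix.\<close>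

lemma finite_simulation:
  assumes "finite_index S E"
  obtains \<rho> where "finite (\<rho> ` lists A)" and "\<And>u. u \<in> lists A \<Longrightarrow> \<rho> u \<in> lists A"
    and "\<And>u v w w'. (u, v) \<in> E \<Longrightarrow> (\<rho> u @ w, \<rho> v @ w') \<in> R \<longleftrightarrow> (u @ w, v @ w') \<in> R"
    and "\<And>u v w w'. (u, v) \<in> E \<Longrightarrow> length w = length w' \<Longrightarrow>
      (\<rho> u @ w, \<rho> v @ w') \<in> E \<longleftrightarrow> (u @ w, v @ w') \<in> E"
proof -
  obtain N where N: "\<forall>u. \<exists>F. finite F \<and> card F \<le> N \<and> F \<subseteq> E `` {u} \<and> E `` {u} \<subseteq> S `` F"
    using finite_index_cover[OF equiv_S equiv_type[OF equiv_E] assms] by (elim exE)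
  define classes where "classes = (\<lambda>u. E `` {u}) ` lists A"
  define enumerates where
    "enumerates C e \<longleftrightarrow> (\<forall>i. e i \<in> C) \<and> (\<forall>v\<in>C. \<exists>i<N. (e i, v) \<in> S)" for C and e :: "nat \<Rightarrow> 'a list"
  have "\<exists>e. enumerates C e" if C: "C \<in> classes" for C
  proof -
    obtain u where u: "u \<in> lists A" "C = E `` {u}"
      using C unfolding classes_def by blast
    obtain F where F: "finite F" "card F \<le> N" "F \<subseteq> C" "C \<subseteq> S `` F"
      using N u(2) by metis
    obtain b where b: "bij_betw b {0..<card F} F"
      using ex_bij_betw_nat_finite[OF F(1)] ..
    have "u \<in> C" using u E_refl by simp
    then have "F \<noteq> {}" using F(4) by blast
    then have "0 < card F" using F(1) by (simp add: card_gt_0_iff)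
    \<comment> \<open>Surplus indices repeat the entry 0, so classes of different sizes share the
      index range below \<open>N\<close>.\<close>
    define e where "e i = b (if i < card F then i else 0)" for i
    have "e i \<in> C" for i
      using bij_betwE[OF b] \<open>0 < card F\<close> F(3) unfolding e_def by auto
    moreover have "\<exists>i<N. (e i, v) \<in> S" if v: "v \<in> C" for v
    proof -
      obtain x where x: "x \<in> F" "(x, v) \<in> S" using v F(4) by blast
      then obtain i where "i < card F" "b i = x"
        using b unfolding bij_betw_def by force
      then show ?thesis
        using x(2) F(2) unfolding e_def by (intro exI[of _ i]) simp
    qed
    ultimately show ?thesis
      unfolding enumerates_def by blast
  qed
  then obtain g where g: "\<And>C. C \<in> classes \<Longrightarrow> enumerates C (g C)"
    by metis
  have g_class: "v \<in> C \<longleftrightarrow> (g C i, v) \<in> E" if C: "C \<in> classes" for C i v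
  proof -
    obtain u where u: "C = E `` {u}"
      using C unfolding classes_def by blast
    moreover have "g C i \<in> C"
      using g[OF C] unfolding enumerates_def by simp
    ultimately have "C = E `` {g C i}"
      using E_Image_eq[of u "g C i"] by simp
    then show ?thesis by (metis Image_singleton_iff)
  qed
  have g_mem: "g C i \<in> C" if "C \<in> classes" for C i
    using g[OF that] unfolding enumerates_def by simp
  have g_lists: "g C i \<in> lists A" if "C \<in> classes" for C i
    using g_mem[OF that] g_class[OF that] E_lists by metis
  have g_length: "length (g C i) = length (g C j)" if "C \<in> classes" for C i j
    using g_class[OF that] g_mem[OF that] E_length by metis
  have g_S: "\<exists>i<N. (g C i, v) \<in> S" if "C \<in> classes" "v \<in> C" for C v
    using g[OF that(1)] that(2) unfolding enumerates_def by blast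

  \<comment> \<open>The value \<open>{}\<close> outside the square leaves only finitely many
    possible functions.\<close>
  define M where "M C = (\<lambda>(i, j). if i < N \<and> j < N then residual (g C i) (g C j) else {})" for C
  define residuals where "residuals = (\<lambda>(u, v). residual u v) ` {(u, v). length u = length v}"
  have "finite residuals"
    using finite_residuals_R unfolding residuals_def residual_def .
  then have "finite {h. \<forall>x. (x \<in> {..<N} \<times> {..<N} \<longrightarrow> h x \<in> residuals) \<and> (x \<notin> {..<N} \<times> {..<N} \<longrightarrow> h x = {})}"
    by (intro finite_set_of_finite_funs) simp_all
  moreover have "M ` classes \<subseteq> {h. \<forall>x. (x \<in> {..<N} \<times> {..<N} \<longrightarrow> h x \<in> residuals) \<and> (x \<notin> {..<N} \<times> {..<N} \<longrightarrow> h x = {})}"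
    using g_length unfolding M_def residuals_def by (auto intro!: image_eqI[of _ _ "(g _ _, g _ _)"])
  ultimately have "finite (M ` classes)"
    by (rule rev_finite_subset)

  \<comment> \<open>As \<open>rep C\<close> depends on \<open>C\<close> only through
    \<open>M C\<close>, finitely many classes are chosen.\<close>
  define rep where "rep C = inv_into classes M (M C)" for C
  have rep: "rep C \<in> classes" "M (rep C) = M C" if "C \<in> classes" for C
    using that unfolding rep_def by (simp_all add: inv_into_into f_inv_into_f)
  have "rep ` classes = inv_into classes M ` M ` classes"
    unfolding rep_def by (simp add: image_image)
  then have "finite (rep ` classes)"
    using \<open>finite (M ` classes)\<close> by simp

  \<comment> \<open>A single \<open>P\<close>-step between extensions of enumerated words is read
    off the matrix. For a chain, each intermediate word is first replaced by an
    \<open>S\<close>-related extension of an enumerated word; hence the generalization over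
    \<open>z\<close>.\<close>
  have transfer: "(g D i @ w, g D k @ w') \<in> E"
    if "(g C i @ w, z) \<in> E" "(g C k @ w', z) \<in> S" "length w' = length w" "i < N" "k < N"
      and C: "C \<in> classes" and D: "D \<in> classes" and M: "M C = M D" for C D i k w w' z
  proof -
    have P: "(g D i @ w, g D j @ w') \<in> P" if "(g C i @ w, g C j @ w') \<in> P" "i < N" "j < N" for i j w w'
    proof -
      have "residual (g C i) (g C j) = residual (g D i) (g D j)"
        using fun_cong[OF M, of "(i, j)"] that(2,3) unfolding M_def by simp
      then show ?thesis
        using that(1) P_append_residual[OF g_length[OF C]] P_append_residual[OF g_length[OF D]] by simp
    qed
    show ?thesis
      using that(1-5)
    proof (induction arbitrary: k w' rule: trancl_induct)
      case (base z)
      have "(g C i @ w, g C k @ w') \<in> P"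
        using P_S[OF S_refl base.hyps S_sym[OF base.prems(1)]] P_lists[OF base.hyps] by blast
      then have "(g D i @ w, g D k @ w') \<in> P"
        using base.prems by (intro P) simp_all
      then show ?case by (rule r_into_trancl)
    next
      case (step y z)
      \<comment> \<open>The front part stays in the class \<open>C\<close> because \<open>E\<close>
        is inherited by prefixes of equal length.\<close>
      define y1 y2 where "y1 = take (length (g C i)) y" and "y2 = drop (length (g C i)) y"
      have y: "y = y1 @ y2" unfolding y1_def y2_def by simp
      have "(g C i, y1) \<in> E"
        using E_take[OF step.hyps(1), of "length (g C i)"] unfolding y1_def by simp
      then have "y1 \<in> C" using g_class[OF C] by simp
      then obtain k' where k': "k' < N" "(g C k', y1) \<in> S"
        using g_S[OF C] by blast
      have "y2 \<in> lists A"
        using E_lists[OF step.hyps(1)] y by simp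
      then have k'_y: "(g C k' @ y2, y) \<in> S"
        unfolding y using k'(2) by (rule S_append[rotated])
      have y2: "length y2 = length w"
        using E_length[OF step.hyps(1)] unfolding y2_def by simp
      have "(g D i @ w, g D k' @ y2) \<in> E"
        using step.IH[OF k'_y y2] step.prems k'(1) by simp
      moreover have "(g C k' @ y2, g C k @ w') \<in> P"
        by (rule P_S[OF k'_y step.hyps(2) S_sym[OF step.prems(1)]])
      then have "(g D k' @ y2, g D k @ w') \<in> P"
        using k'(1) step.prems by (intro P) simp_all
      ultimately show ?case by (rule trancl_into_trancl)
    qed
  qed

  define cls where "cls u = E `` {u}" for u
  have cls: "cls u \<in> classes" "u \<in> cls u" if "u \<in> lists A" for u
    using that E_refl unfolding cls_def classes_def by auto
  have cls_eq: "cls u = cls v" if "(u, v) \<in> E" for u v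
    using E_Image_eq[OF that] unfolding cls_def .
  have "\<forall>u. \<exists>i. u \<in> lists A \<longrightarrow> i < N \<and> (g (cls u) i, u) \<in> S"
    using g_S cls by blast
  then obtain idx where idx: "\<And>u. u \<in> lists A \<Longrightarrow> idx u < N \<and> (g (cls u) (idx u), u) \<in> S"
    by metis
  \<comment> \<open>The position within the class is kept while the class is exchanged for its
    representative.\<close>
  define \<rho> where "\<rho> u = g (rep (cls u)) (idx u)" for u
  show ?thesis
  proof (rule that[of \<rho>])
    have "\<rho> ` lists A \<subseteq> (\<lambda>(C, i). g C i) ` ((rep ` classes) \<times> {..<N})"
      using cls(1) idx unfolding \<rho>_def by auto
    then show "finite (\<rho> ` lists A)"
      by (rule finite_subset) (simp add: \<open>finite (rep ` classes)\<close>)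
    show "\<rho> u \<in> lists A" if "u \<in> lists A" for u
      unfolding \<rho>_def using rep(1)[OF cls(1)[OF that]] by (rule g_lists)
  next
    fix u v w w' assume uv: "(u, v) \<in> E"
    then have u: "u \<in> lists A" and v: "v \<in> lists A" using E_lists by blast+
    define C where "C = cls u"
    have C: "C \<in> classes" and C_v: "cls v = C"
      using cls(1)[OF u] cls_eq[OF uv] unfolding C_def by simp_all
    have u_idx: "idx u < N" "(g C (idx u), u) \<in> S" and v_idx: "idx v < N" "(g C (idx v), v) \<in> S"
      using idx[OF u] idx[OF v] C_v unfolding C_def by simp_all
    have \<rho>: "\<rho> u = g (rep C) (idx u)" "\<rho> v = g (rep C) (idx v)"
      unfolding \<rho>_def C_v by (simp_all add: C_def)
    have "residual (\<rho> u) (\<rho> v) = M (rep C) (idx u, idx v)"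
      unfolding \<rho> M_def using u_idx(1) v_idx(1) by simp
    also have "\<dots> = M C (idx u, idx v)"
      unfolding rep(2)[OF C] ..
    also have "\<dots> = residual (g C (idx u)) (g C (idx v))"
      unfolding M_def using u_idx(1) v_idx(1) by simp
    also have "\<dots> = residual u v"
      using u_idx(2) v_idx(2) by (rule residual_S)
    finally show "(\<rho> u @ w, \<rho> v @ w') \<in> R \<longleftrightarrow> (u @ w, v @ w') \<in> R"
      unfolding residual_def set_eq_iff by fastforce
    assume len: "length w = length w'"
    show "(\<rho> u @ w, \<rho> v @ w') \<in> E \<longleftrightarrow> (u @ w, v @ w') \<in> E"
    proof
      assume E: "(\<rho> u @ w, \<rho> v @ w') \<in> E"
      then have w: "w \<in> lists A" "w' \<in> lists A" "\<rho> v @ w' \<in> lists A"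
        using E_lists by fastforce+
      have "(g C (idx u) @ w, g C (idx v) @ w') \<in> E"
        using transfer[OF E[unfolded \<rho>] S_refl _ u_idx(1) v_idx(1) rep(1)[OF C] C rep(2)[OF C]]
          w(3) len \<rho>(2) by simp
      then show "(u @ w, v @ w') \<in> E"
        using S_subset_E[OF S_append[OF S_sym[OF u_idx(2)] w(1)]]
          S_subset_E[OF S_append[OF v_idx(2) w(2)]] by (meson trancl_trans)
    next
      assume E: "(u @ w, v @ w') \<in> E"
      then have w: "w \<in> lists A" "w' \<in> lists A"
        using E_lists by fastforce+
      have "(g C (idx u) @ w, v @ w') \<in> E"
        using S_subset_E[OF S_append[OF u_idx(2) w(1)]] E by (rule trancl_trans)
      then show "(\<rho> u @ w, \<rho> v @ w') \<in> E"
        unfolding \<rho> using len rep[OF C] C u_idx(1) v_idx(1)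
        by (intro transfer[OF _ S_append[OF v_idx(2) w(2)]]) simp_all
    qed
  qed
qed

lemma KerSeq_if_finite_index_S_E:
  assumes "finite_index S E"
  shows "R \<in> KerSeq"
proof -
  obtain \<rho> where fin: "finite (\<rho> ` lists A)" and \<rho>_lists: "\<And>u. u \<in> lists A \<Longrightarrow> \<rho> u \<in> lists A"
    and \<rho>_R: "\<And>u v w w'. (u, v) \<in> E \<Longrightarrow> (\<rho> u @ w, \<rho> v @ w') \<in> R \<longleftrightarrow> (u @ w, v @ w') \<in> R"
    and \<rho>_E: "\<And>u v w w'. (u, v) \<in> E \<Longrightarrow> length w = length w' \<Longrightarrow>
      (\<rho> u @ w, \<rho> v @ w') \<in> E \<longleftrightarrow> (u @ w, v @ w') \<in> E"
    using finite_simulation[OF assms] by blast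
  define Q where "Q = \<rho> ` lists A"
  have "finite Q" and Q_lists: "Q \<subseteq> lists A" and \<rho>_Q: "\<And>u. u \<in> lists A \<Longrightarrow> \<rho> u \<in> Q"
    using fin \<rho>_lists unfolding Q_def by auto
  \<comment> \<open>\<open>\<kappa>\<close> numbers the \<open>R\<close>-classes of states by
    numbers below \<open>K\<close>, which will serve as amounts of padding. Below,
    \<open>\<nu>\<close> names the \<open>E\<close>-classes that a state can enter by one
    letter.\<close>
  obtain \<kappa> :: "'a list set \<Rightarrow> nat" and K where
    \<kappa>: "\<kappa> ` (\<lambda>p. R `` {p}) ` Q = {i. i < K}" "inj_on \<kappa> ((\<lambda>p. R `` {p}) ` Q)"
    using finite_imp_inj_to_nat_seg[OF finite_imageI[OF \<open>finite Q\<close>]] by metis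
  have "finite ((\<lambda>(p, a). E `` {p @ [a]}) ` (Q \<times> A))"
    using \<open>finite Q\<close> finite_A by simp
  then obtain \<nu> :: "'a list set \<Rightarrow> nat" where \<nu>: "inj_on \<nu> ((\<lambda>(p, a). E `` {p @ [a]}) ` (Q \<times> A))"
    using finite_imp_inj_to_nat_seg by metis
  define rank where "rank p = \<kappa> (R `` {p})" for p
  \<comment> \<open>First the padding left by \<open>p\<close> is completed to \<open>K\<close>
    zeros, then the new \<open>E\<close>-class is named, then the new padding begins. A name may be
    0 as well; it is recognized by its position.\<close>
  define out where "out p a =
    replicate (K - rank p) 0 @ \<nu> (E `` {p @ [a]}) # replicate (rank (\<rho> (p @ [a]))) 0" for p a
  define run where "run = foldl (\<lambda>(p, x) a. (\<rho> (p @ [a]), x @ out p a)) (\<rho> [], [])"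
  define st where "st u = fst (run u)" for u
  define f where "f u = snd (run u)" for u
  have st_Nil: "st [] = \<rho> []" and f_Nil: "f [] = []"
    unfolding st_def f_def run_def by simp_all
  have st_snoc: "st (u @ [a]) = \<rho> (st u @ [a])" and f_snoc: "f (u @ [a]) = f u @ out (st u) a" for u a
    unfolding st_def f_def run_def by (simp_all add: case_prod_unfold)
  have st_Q: "st u \<in> Q" if "u \<in> lists A" for u
    using that
  proof (induction u rule: rev_induct)
    case (snoc a u)
    then have "st u @ [a] \<in> lists A" using Q_lists by auto
    then show ?case unfolding st_snoc by (rule \<rho>_Q)
  qed (simp add: st_Nil \<rho>_Q)
  \<comment> \<open>Within an \<open>E\<close>-class, states can stand for the words read. All
    extensions are included because the next letter and the application of \<open>\<rho>\<close>
    after it consume them in the induction.\<close>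
  have st_E: "\<forall>w w'. ((st u @ w, st v @ w') \<in> R \<longleftrightarrow> (u @ w, v @ w') \<in> R) \<and>
      (length w = length w' \<longrightarrow> ((st u @ w, st v @ w') \<in> E \<longleftrightarrow> (u @ w, v @ w') \<in> E))"
    if "(u, v) \<in> E" for u v
    using that
  proof (induction u arbitrary: v rule: rev_induct)
    case Nil
    then have "v = []" using E_length[OF Nil] by simp
    then show ?case using \<rho>_R[OF Nil] \<rho>_E[OF Nil] by (simp add: st_Nil)
  next
    case (snoc a u)
    obtain v' b where v: "v = v' @ [b]"
      using E_length[OF snoc.prems] by (cases v rule: rev_cases) simp_all
    have "(u, v') \<in> E"
      using E_prefix snoc.prems E_length[OF snoc.prems] unfolding v by simp
    note IH = snoc.IH[OF this]
    have E: "(st u @ [a], st v' @ [b]) \<in> E"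
      using IH[rule_format, of "[a]" "[b]"] snoc.prems v by simp
    show ?case
      unfolding v st_snoc
      using \<rho>_R[OF E] \<rho>_E[OF E] IH by simp
  qed
  define r where "r u = rank (st u)" for u
  have r_less: "r u < K" if "u \<in> lists A" for u
    using \<kappa>(1) st_Q[OF that] unfolding r_def rank_def by blast
  have r_iff: "r u = r v \<longleftrightarrow> (u, v) \<in> R" if "(u, v) \<in> E" for u v
  proof -
    have uv: "st u \<in> Q" "st v \<in> Q" using that E_lists st_Q by blast+
    then have "r u = r v \<longleftrightarrow> R `` {st u} = R `` {st v}"
      unfolding r_def rank_def using \<kappa>(2) by (simp add: inj_on_eq_iff)
    also have "\<dots> \<longleftrightarrow> (st u, st v) \<in> R"
      using uv Q_lists by (intro eq_equiv_class_iff[OF equiv_R]) auto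
    also have "\<dots> \<longleftrightarrow> (u, v) \<in> R"
      using st_E[OF that, rule_format, of "[]" "[]"] by simp
    finally show ?thesis .
  qed
  \<comment> \<open>The word \<open>code u\<close> determines, and is determined by, the \<open>E\<close>-class of \<open>u\<close>; the number
    of zeros missing from \<open>f u\<close> determines the \<open>R\<close>-class of \<open>u\<close> within it.\<close>
  define code where "code u = f u @ replicate (K - r u) 0" for u
  have code_snoc: "code (u @ [a]) = code u @ \<nu> (E `` {st u @ [a]}) # replicate K 0"
    if "u @ [a] \<in> lists A" for u a
  proof -
    have "r (u @ [a]) + (K - r (u @ [a])) = K"
      using r_less[OF that] by simp
    then show ?thesis
      unfolding code_def f_snoc out_def
      by (simp add: r_def st_snoc replicate_add[symmetric])
  qed
  have code_length: "length (code u) = K - r [] + Suc K * length u" if "u \<in> lists A" for u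
    using that
  proof (induction u rule: rev_induct)
    case Nil
    show ?case by (simp add: code_def f_Nil)
  next
    case (snoc a u)
    then show ?case using code_snoc[OF snoc.prems] by simp
  qed
  have code_iff: "code u = code v \<longleftrightarrow> (u, v) \<in> E"
    if "u \<in> lists A" "v \<in> lists A" "length u = length v" for u v
    using that
  proof (induction u arbitrary: v rule: rev_induct)
    case Nil
    then show ?case using E_refl[OF Nil(1)] by simp
  next
    case (snoc a u)
    obtain v' b where v: "v = v' @ [b]"
      using snoc.prems by (cases v rule: rev_cases) simp_all
    have in_lists: "u \<in> lists A" "a \<in> A" "v' \<in> lists A" "b \<in> A" "length u = length v'"
      using snoc.prems v by simp_all
    \<comment> \<open>Codes of words of equal length have equal length, so the last blocks are
      aligned.\<close>
    have "code (u @ [a]) = code v \<longleftrightarrow>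
        code u = code v' \<and> \<nu> (E `` {st u @ [a]}) = \<nu> (E `` {st v' @ [b]})"
      using code_snoc[OF snoc.prems(1)] code_snoc[of v' b] snoc.prems(2) v
        code_length[OF in_lists(1)] code_length[OF in_lists(3)] in_lists(5) by simp
    also have "\<dots> \<longleftrightarrow> (u, v') \<in> E \<and> (st u @ [a], st v' @ [b]) \<in> E"
    proof -
      have "(st u, a) \<in> Q \<times> A" "(st v', b) \<in> Q \<times> A"
        using in_lists st_Q by simp_all
      then have "\<nu> (E `` {st u @ [a]}) = \<nu> (E `` {st v' @ [b]}) \<longleftrightarrow> E `` {st u @ [a]} = E `` {st v' @ [b]}"
        using inj_on_eq_iff[OF \<nu>, of "E `` {st u @ [a]}" "E `` {st v' @ [b]}"] by (auto intro: rev_image_eqI)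
      also have "\<dots> \<longleftrightarrow> (st u @ [a], st v' @ [b]) \<in> E"
        using in_lists st_Q Q_lists by (intro eq_equiv_class_iff[OF equiv_E]) auto
      finally show ?thesis
        using snoc.IH[OF in_lists(1,3,5)] by simp
    qed
    \<comment> \<open>Given \<open>(u, v') \<in> E\<close>, \<open>st_E\<close> passes from states
      to words. Conversely \<open>E_prefix\<close> recovers this from the longer words.\<close>
    also have "\<dots> \<longleftrightarrow> (u @ [a], v) \<in> E"
      using st_E[of u v', rule_format, of "[a]" "[b]"] E_prefix[of u "[a]" v' "[b]"] in_lists(5) v by auto
    finally show ?case .
  qed
  have f_iff: "f u = f v \<longleftrightarrow> (u, v) \<in> R" if u: "u \<in> lists A" and v: "v \<in> lists A" for u v
  proof
    assume f: "f u = f v"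
    \<comment> \<open>Since \<open>r x < K\<close>, the length of the image alone determines
      \<open>length x\<close> and \<open>r x\<close> as quotient and remainder modulo
      \<open>Suc K\<close>. Equal images thus also have equal codes.\<close>
    have len: "length (f x) + K = K - r [] + Suc K * length x + r x" if "x \<in> lists A" for x
      using code_length[OF that] r_less[OF that] unfolding code_def by simp
    have "Suc K * length u + r u = Suc K * length v + r v"
      using len[OF u] len[OF v] f by simp
    moreover have "(Suc K * length x + r x) div Suc K = length x" "(Suc K * length x + r x) mod Suc K = r x"
      if "x \<in> lists A" for x
      using div_mult_self2[of "Suc K" "r x" "length x"] mod_mult_self2[of "r x" "Suc K" "length x"]
        r_less[OF that] by (simp_all add: add.commute del: mult_Suc)
    ultimately have "length u = length v" "r u = r v"
      using u v by metis+
    then have "(u, v) \<in> E"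
      using code_iff[OF u v] f unfolding code_def by simp
    then show "(u, v) \<in> R"
      using r_iff \<open>r u = r v\<close> by simp
  next
    assume R: "(u, v) \<in> R"
    then have "(u, v) \<in> E" using R_subset_E by blast
    then have "code u = code v" "r u = r v"
      using code_iff[OF u v R_length[OF R]] r_iff R by simp_all
    then show "f u = f v" unfolding code_def by simp
  qed
  have "kernel_on A f = R"
    using f_iff R_lists unfolding kernel_on_def by blast
  moreover have "kernel_on A f \<in> KerSeq"
  proof (rule KerSeqI[OF finite_A \<open>finite Q\<close> st_Q])
    show "st (u @ [a]) = \<rho> (st u @ [a])" for u a by (rule st_snoc)
    show "\<rho> (p @ [a]) \<in> Q" if "p \<in> Q" "a \<in> A" for p a
      using that Q_lists by (intro \<rho>_Q) auto
    show "f (u @ [a]) = f u @ out (st u) a" for u a by (rule f_snoc)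
  qed (simp_all only: f_Nil)
  ultimately show ?thesis by simp
qed

end

section \<open>Combination of both directions with the stabilization of powers\<close>

theorem theorem16:
  fixes A :: "'a set" and R :: "'a list rel" and T :: "('q, 'a, 'a) transducer"
  defines "S \<equiv> syntactic_congruence A R" and "P \<equiv> prefix_closure A R"
  assumes "finite A"
    and "equiv (lists A) R"
    and "finite_transducer A A T" and "letter_to_letter A A T" and "realized_rel T = R"
  shows "(R \<in> KerSeq \<longleftrightarrow> finite_index S R \<and> finite_index R (P\<^sup>+)) \<and>
         (finite_index S R \<and> finite_index R (P\<^sup>+) \<longleftrightarrow>
            finite_index S R \<and> finite_index R P \<and> (\<exists>k\<ge>1. P ^^ k = P ^^ Suc k))"
proof -
  interpret sync: synchronous_equiv A R
  proof
    show "length u = length v" if "(u, v) \<in> R" for u v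
      using that letter_to_letter_length[OF _ assms(6)] unfolding assms(7)[symmetric] realized_rel_def
      by auto
    show "finite ((\<lambda>(u, v). {(w, w'). (u @ w, v @ w') \<in> R}) ` {(u, v). length u = length v})"
      using finite_residuals[OF assms(6,5)] unfolding assms(7) .
  qed (rule assms(3,4))+
  have "finite_index S R \<and> finite_index R (P\<^sup>+)" if R: "R \<in> KerSeq"
  proof -
    obtain A' B and f :: "'a list \<Rightarrow> nat list" and T' :: "(nat, 'a, nat) transducer" where
      T': "finite B" "finite_transducer A' B T'" "sequential A' B T'"
        "realized_rel T' = {(u, f u) | u. u \<in> lists A'}" and ker: "R = kernel_on A' f"
      using R unfolding KerSeq_def by auto
    \<comment> \<open>Membership in \<open>KerSeq\<close> supplies its own alphabet, but
      \<open>R\<close> determines its domain as the set of words related to themselves.\<close>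
    have "u \<in> lists A \<longleftrightarrow> u \<in> lists A'" for u
      using sync.R_refl[of u] sync.R_lists[of u u] ker unfolding kernel_on_def by auto
    then have lists_eq: "lists A' = lists A" by blast
    obtain st out where st: "\<And>u. u \<in> lists A' \<Longrightarrow> st u \<in> states T'"
      "\<And>u w. u \<in> lists A' \<Longrightarrow> w \<in> lists A' \<Longrightarrow> f (u @ w) = f u @ out (st u) w"
      "\<And>u. u \<in> lists A' \<Longrightarrow> f u \<in> lists B"
      using sequential_residual[OF T'(2-4)] by blast
    interpret ker: sequential_kernel A R f st out "states T'" B
    proof
      show "finite (states T')" using T'(2) by (simp add: finite_transducer_def)
      show "R = kernel_on A f" using ker unfolding kernel_on_def lists_eq .
    qed (use T'(1) st in \<open>simp_all add: lists_eq del: in_lists_conv_set\<close>)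
    show ?thesis
      using ker.finite_index_S_R ker.finite_index_R_E unfolding S_def P_def by blast
  qed
  moreover have "R \<in> KerSeq" if "finite_index S R \<and> finite_index R (P\<^sup>+)"
    using that sync.finite_index_S_E_iff sync.KerSeq_if_finite_index_S_E unfolding S_def P_def by blast
  ultimately show ?thesis
    using sync.finite_index_iff_stable unfolding S_def P_def by blast
qed

end
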